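(* Let $\mathcal{C}$ be an $[n,k,d]_q$ MDS code of distance $d\ge 3$ and covering radius $d-2$, with parity check matrix $H_{\mathcal{C}}$, let $1\le\Delta\le n-d$, and let $\mathcal{C}_\Delta$ be the $[n-\Delta,k-\Delta,d]_q$ MDS code, of covering radius $d-1$, whose parity check matrix is obtained from $H_{\mathcal{C}}$ by removing $\Delta$ columns. Then the total number $\mathbb{N}_\Sigma^{(d-1)}(\mathcal{C}_\Delta)$ of weight $d-1$ cosets of $\mathcal{C}_\Delta$ satisfies $\mathbb{N}_\Sigma^{(d-1)}(\mathcal{C}_\Delta)\ge(q-1)\Delta$, and the total number of deep holes of $\mathcal{C}_\Delta$ equals $q^{k-\Delta}\,\mathbb{N}_\Sigma^{(d-1)}(\mathcal{C}_\Delta)$. Also: (i) Let $d\in\{3,4\}$, with $q$ odd if $d=4$, and let $\mathcal{C}$ be the $[q+1,q-d+2,d]_q$ GDRS code (of covering radius $d-2$) with parity check matrix $H_d$. Then $\mathbb{N}_\Sigma^{(d-1)}(\mathcal{C}_\Delta)=(q-1)\Delta$ if $\Delta\le q+1-n_d(q)$, where $n_3(q)=3$ for any $q$ and $n_4(q)=(q+5)/2$ for odd $q$. (ii) Let $q$ be even, and let $\mathcal{C}$ be the $[q+2,q-1,4]_q$ code (of covering radius $2$) with parity check matrix $\widetilde{H_4}$. Let $\Delta\le q+2-\left(1+\frac{q+4}{2}\right)$ and suppose that the column proportional to $(0,1,0)^{tr}$ is among the removed columns. Then (with $d=4$) $\mathbb{N}_\Sigma^{(d-1)}(\mathcal{C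}_\Delta)=(q-1)\Delta$.
   Context: An $[n,k,d]_q$ code is a $k$-dimensional $\mathbb{F}_q$-linear subspace of $\mathbb{F}_q^n$ with minimum Hamming distance $d$; it is MDS if $d=n-k+1$. The covering radius $R$ is the least integer such that every vector of the ambient space is within Hamming distance $R$ of some codeword; a deep hole is a vector whose minimum distance to the code is exactly $R$. A coset of a code is a translate of it; the weight of a coset is the smallest Hamming weight of a vector in it. $H_d$ is the $(d-1)\times(q+1)$ matrix whose columns are nonzero scalar multiples of $(1,t,t^2,\ldots,t^{d-2})^{tr}$, $t\in\mathbb{F}_q$, and of $(0,\ldots,0,1)^{tr}$. For $q$ even, $\widetilde{H_4}$ is the $3\times(q+2)$ matrix whose columns are nonzero scalar multiples of $(1,t,t^2)^{tr}$, $t\in\mathbb{F}_q$, of $(0,0,1)^{tr}$ and of $(0,1,0)^{tr}$. (That $\mathcal{C}_\Delta$ is an $[n-\Delta,k-\Delta,d]_q$ MDS code of covering radius $d-1$ is known.) *)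

theory Defs
  imports
    "HOL-Library.Cardinality"
    "HOL-Algebra.AbelCoset"
    "Jordan_Normal_Form.Matrix_Kernel"
    "Jordan_Normal_Form.DL_Submatrix"
begin

text \<open>The ground field is a type \<open>'a :: {field, finite}\<close>, so \<open>q = CARD('a)\<close>, and the ambient
  space \<open>F_q^n\<close> is \<open>carrier_vec n\<close>.\<close>

definition hamming_weight :: "'a::zero vec \<Rightarrow> nat" where
  "hamming_weight v = card {i. i < dim_vec v \<and> v $ i \<noteq> 0}"

definition hamming_dist :: "'a vec \<Rightarrow> 'a vec \<Rightarrow> nat" where
  "hamming_dist v w = card {i. i < dim_vec v \<and> v $ i \<noteq> w $ i}"

text \<open>The infimum over the empty set of naturals is 0, so \<open>min_distance\<close> is 0 on a code with
  at most one word, and positive on any other code.\<close>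

definition min_distance :: "'a vec set \<Rightarrow> nat" where
  "min_distance C = Inf {hamming_dist x y | x y. x \<in> C \<and> y \<in> C \<and> x \<noteq> y}"

definition linear_code :: "nat \<Rightarrow> nat \<Rightarrow> nat \<Rightarrow> 'a::{field,finite} vec set \<Rightarrow> bool" where
  "linear_code n k d C \<longleftrightarrow>
     VectorSpace.subspace class_ring C (module_vec TYPE('a) n) \<and>
     vectorspace.dim class_ring ((module_vec TYPE('a) n)\<lparr>carrier := C\<rparr>) = k \<and>
     min_distance C = d"

definition mds_code :: "nat \<Rightarrow> nat \<Rightarrow> nat \<Rightarrow> 'a::{field,finite} vec set \<Rightarrow> bool" where
  "mds_code n k d C \<longleftrightarrow> linear_code n k d C \<and> d = n - k + 1"

definition dist_to_code :: "'a vec set \<Rightarrow> 'a vec \<Rightarrow> nat" where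
  "dist_to_code C v = Inf (hamming_dist v ` C)"

definition covering_radius :: "nat \<Rightarrow> 'a vec set \<Rightarrow> nat" where
  "covering_radius n C = (LEAST R. \<forall>v \<in> carrier_vec n. \<exists>c \<in> C. hamming_dist v c \<le> R)"

definition deep_holes :: "nat \<Rightarrow> 'a vec set \<Rightarrow> 'a vec set" where
  "deep_holes n C = {v \<in> carrier_vec n. dist_to_code C v = covering_radius n C}"

definition coset_weight :: "'a::zero vec set \<Rightarrow> nat" where
  "coset_weight K = Inf (hamming_weight ` K)"

text \<open>\<open>num_cosets n w C\<close> is the number of cosets of weight \<open>w\<close>; it counts the cosets as sets,
  not their leaders.\<close>

definition num_cosets :: "nat \<Rightarrow> nat \<Rightarrow> 'a::{field,finite} vec set \<Rightarrow> nat" where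
  "num_cosets n w C =
     card {K \<in> a_rcosets\<^bsub>module_vec TYPE('a) n\<^esub> C. coset_weight K = w}"

text \<open>The number \<open>n - k\<close> of rows makes a parity check matrix of a \<open>k\<close>-dimensional code have
  full row rank.\<close>

definition parity_check_matrix ::
    "nat \<Rightarrow> nat \<Rightarrow> 'a::{field,finite} vec set \<Rightarrow> 'a mat \<Rightarrow> bool" where
  "parity_check_matrix n k C H \<longleftrightarrow> H \<in> carrier_mat (n - k) n \<and> mat_kernel H = C"

definition remove_cols :: "'a mat \<Rightarrow> nat set \<Rightarrow> 'a mat" where
  "remove_cols H D = submatrix H UNIV (- D)"

text \<open>The columns of \<open>H\<close> are, in some order, nonzero scalar multiples of the vectors in \<open>S\<close>,
  exactly one column for each vector.\<close>

definition scaled_columns :: "'a::field mat \<Rightarrow> 'a vec set \<Rightarrow> bool" where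
  "scaled_columns H S \<longleftrightarrow>
     (\<exists>p. bij_betw p {..<dim_col H} S \<and>
          (\<forall>j < dim_col H. \<exists>a. a \<noteq> 0 \<and> col H j = a \<cdot>\<^sub>v p j))"

text \<open>Rows are indexed from 0: \<open>unit_vec (d - 1) (d - 2)\<close> is \<open>(0,\<dots>,0,1)\<close>, and
  \<open>unit_vec 3 1\<close> below is \<open>(0,1,0)\<close>.\<close>

definition gdrs_points :: "nat \<Rightarrow> 'a::field vec set" where
  "gdrs_points d =
     insert (unit_vec (d - 1) (d - 2)) (range (\<lambda>t. vec (d - 1) (\<lambda>i. t ^ i)))"

definition is_H :: "nat \<Rightarrow> 'a::{field,finite} mat \<Rightarrow> bool" where
  "is_H d H \<longleftrightarrow>
     H \<in> carrier_mat (d - 1) (CARD('a) + 1) \<and> scaled_columns H (gdrs_points d)"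

definition is_H4_tilde :: "'a::{field,finite} mat \<Rightarrow> bool" where
  "is_H4_tilde H \<longleftrightarrow>
     H \<in> carrier_mat 3 (CARD('a) + 2) \<and>
     scaled_columns H (insert (unit_vec 3 1) (gdrs_points 4))"

text \<open>The quantity \<open>n_d(q)\<close>, meaningful for \<open>d = 3\<close>, and for \<open>d = 4\<close> with \<open>q\<close> odd, when the
  division is exact.\<close>

definition n_bound :: "nat \<Rightarrow> nat \<Rightarrow> nat" where
  "n_bound d q = (if d = 3 then 3 else (q + 5) div 2)"

end

theory Submission
  imports Defs
begin

text \<open>Cosets of \<open>C = ker H\<close> correspond to syndromes \<open>s\<close>, and the weight of a coset is the least number
  of columns of \<open>H\<close> whose span contains \<open>s\<close>. The code with \<open>r = d - 1\<close> check rows is MDS iff any \<open>r\<close> columns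
  are linearly independent, and then any \<open>r\<close> columns span all syndromes. Hence after removing columns
  the weight is at most \<open>r\<close>, and it is \<open>r\<close> for the multiples of a removed column. Equality holds
  once every other syndrome needs fewer than \<open>r\<close> of the remaining columns. For \<open>r = 2\<close> the columns
  are all points of the projective line. For \<open>r = 3\<close> a point off the arc that is on no secant of the
  remaining set \<open>S\<close> pairs all but the tangent points of \<open>S\<close> with removed points; there are at most
  two tangents (conic, \<open>q\<close> odd) or none (hyperoval), so \<open>S\<close> would be too small.\<close>

section \<open>Codes, syndromes and cosets\<close>

text \<open>Linear algebra is replaced by counting: on \<open>r\<close> coordinates there are
  \<open>q ^ r\<close> words for \<open>q ^ r\<close> syndromes, so injectivity already gives
  spanning, and \<open>r + 1\<close> coordinates force a collision. Words of the smaller code are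
  treated as words of the old length that vanish on \<open>D\<close>, so columns keep their indices
  and stay comparable with the removed ones. The tangent argument can fail only if
  \<open>n <= t + 2 * card D\<close>, where \<open>t\<close> bounds the tangents through a point off
  the arc. For the conic, \<open>n = q + 1\<close> and \<open>t = 2\<close>, so success means
  \<open>card D <= (q - 3) / 2\<close>, which is \<open>q + 1 - (q + 5) / 2\<close>; this is the
  origin of \<open>n_4(q)\<close>. Parity is the obstacle: for even \<open>q\<close> all tangents of
  the conic pass through \<open>(0,1,0)\<close>, so \<open>t = 2\<close> fails there. Adjoining that
  point gives an arc of \<open>q + 2\<close> points, and every line through one of them is a secant,
  so \<open>t = 0\<close>.\<close>

definition supp :: "'a::zero vec \<Rightarrow> nat set" where
  "supp v = {i. i < dim_vec v \<and> v $ i \<noteq> 0}"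

text \<open>Nonempty fibers are the cosets of the kernel, so a coset is named by its syndrome
  \<open>s\<close>; for an \<open>s\<close> that is no syndrome the fiber is empty.\<close>

definition fiber :: "'a::semiring_0 mat \<Rightarrow> 'a vec \<Rightarrow> 'a vec set" where
  "fiber H s = {x \<in> carrier_vec (dim_col H). H *\<^sub>v x = s}"

lemma hamming_weight_supp: "hamming_weight v = card (supp v)"
  by (simp add: hamming_weight_def supp_def)

lemma finite_supp [simp]: "finite (supp v)"
  by (simp add: supp_def)

lemma supp_subset: "v \<in> carrier_vec n \<Longrightarrow> supp v \<subseteq> {..<n}"
  by (auto simp: supp_def)

lemma not_in_supp: "v \<in> carrier_vec n \<Longrightarrow> i < n \<Longrightarrow> i \<notin> supp v \<Longrightarrow> v $ i = 0"
  by (auto simp: supp_def)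

lemma supp_minus:
  fixes v :: "'a::ring vec"
  assumes "v \<in> carrier_vec n" "w \<in> carrier_vec n"
  shows "supp (v - w) \<subseteq> supp v \<union> supp w"
  using assms by (auto simp: supp_def)

lemma supp_empty_iff: "v \<in> carrier_vec n \<Longrightarrow> supp v = {} \<longleftrightarrow> v = 0\<^sub>v n"
  by (auto simp: supp_def intro!: eq_vecI)

lemma hamming_dist_minus:
  fixes v :: "'a::ring vec"
  assumes "v \<in> carrier_vec n" "w \<in> carrier_vec n"
  shows "hamming_dist v w = hamming_weight (v - w)"
proof -
  have "{i. i < dim_vec v \<and> v $ i \<noteq> w $ i} = {i. i < dim_vec (v - w) \<and> (v - w) $ i \<noteq> 0}"
    using assms by auto
  then show ?thesis by (simp add: hamming_dist_def hamming_weight_def)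
qed

text \<open>Feeds the comparison of words with syndromes: \<open>q ^ r\<close> words on
  \<open>r\<close> coordinates match the number of vectors of length \<open>r\<close>, and
  \<open>q ^ (r + 1)\<close> words exceed it.\<close>

lemma card_vecs_supported:
  assumes "J \<subseteq> {..<n}"
  shows "card {v \<in> carrier_vec n :: 'a::{zero,finite} vec set. supp v \<subseteq> J} = CARD('a) ^ card J"
proof -
  have fin: "finite J" using assms finite_subset by blast
  have "bij_betw (\<lambda>f. vec n (\<lambda>i. if i \<in> J then f i else 0)) (PiE J (\<lambda>_. UNIV :: 'a set))
      {v \<in> carrier_vec n. supp v \<subseteq> J}"
  proof (rule bij_betw_byWitness[where f' = "\<lambda>v. restrict (vec_index v) J"], goal_cases)
    case 1
    show ?case
    proof
      fix f assume "f \<in> PiE J (\<lambda>_. UNIV :: 'a set)"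
      then show "restrict (vec_index (vec n (\<lambda>i. if i \<in> J then f i else 0))) J = f"
        using assms by (intro ext) (auto simp: restrict_def PiE_def extensional_def)
    qed
  next
    case 2
    then show ?case by (auto intro!: eq_vecI simp: supp_def)
  next
    case 3
    then show ?case by (auto simp: supp_def)
  next
    case 4
    then show ?case by auto
  qed
  then show ?thesis
    using fin by (simp add: bij_betw_same_card[symmetric] card_PiE)
qed

lemma card_carrier_vec: "card (carrier_vec n :: 'a::{zero,finite} vec set) = CARD('a) ^ n"
proof -
  have "{v \<in> carrier_vec n :: 'a vec set. supp v \<subseteq> {..<n}} = carrier_vec n"
    using supp_subset by blast
  with card_vecs_supported[of "{..<n}" n, where 'a = 'a] show ?thesis by simp
qed

lemma finite_carrier_vec [simp]: "finite (carrier_vec n :: 'a::{zero,finite} vec set)"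
  by (rule card_ge_0_finite) (simp add: card_carrier_vec)

lemma vec_minus_eq_0_iff:
  fixes v :: "'a::ring vec"
  assumes "v \<in> carrier_vec n" "w \<in> carrier_vec n"
  shows "v - w = 0\<^sub>v n \<longleftrightarrow> v = w"
proof
  assume "v - w = 0\<^sub>v n"
  then have "(v - w) $ i = 0" if "i < n" for i using that by simp
  then show "v = w" using assms by (intro eq_vecI) auto
qed (use assms in auto)

lemma fiber_eq_translate:
  fixes H :: "'a::{field,finite} mat"
  assumes H: "H \<in> carrier_mat r n" and x: "x \<in> carrier_vec n"
  shows "fiber H (H *\<^sub>v x) = (\<lambda>c. c + x) ` mat_kernel H"
proof (intro Set.set_eqI iffI)
  fix y assume "y \<in> fiber H (H *\<^sub>v x)"
  then have y: "y \<in> carrier_vec n" "H *\<^sub>v y = H *\<^sub>v x" using H by (auto simp: fiber_def)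
  then have "H *\<^sub>v (y - x) = 0\<^sub>v r" using H x by (simp add: mult_minus_distrib_mat_vec)
  then have "y - x \<in> mat_kernel H" using y x by (intro mat_kernelI[OF H]) auto
  moreover have "y = (y - x) + x" using x y by (intro eq_vecI) auto
  ultimately show "y \<in> (\<lambda>c. c + x) ` mat_kernel H" by blast
next
  fix y assume "y \<in> (\<lambda>c. c + x) ` mat_kernel H"
  then obtain c where "c \<in> mat_kernel H" and y: "y = c + x" by blast
  with mat_kernelD[OF H] have "c \<in> carrier_vec n" "H *\<^sub>v c = 0\<^sub>v r" by auto
  then show "y \<in> fiber H (H *\<^sub>v x)"
    using H x by (simp add: fiber_def y mult_add_distrib_mat_vec[OF H])
qed

lemma card_fiber:
  fixes H :: "'a::{field,finite} mat"
  assumes "H \<in> carrier_mat r n" "x \<in> carrier_vec n"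
  shows "card (fiber H (H *\<^sub>v x)) = card (mat_kernel H)"
proof -
  have "inj_on (\<lambda>c. c + x) (mat_kernel H)"
  proof (rule inj_onI)
    fix c c' assume c: "c \<in> mat_kernel H" "c' \<in> mat_kernel H" "c + x = c' + x"
    have "c \<in> carrier_vec n" "c' \<in> carrier_vec n"
      using c mat_kernel_carrier[OF assms(1)] by auto
    moreover have "(c + x) $ i = (c' + x) $ i" for i using c by simp
    ultimately show "c = c'" using assms(2) by (intro eq_vecI) (auto, metis add_right_cancel index_add_vec(1) carrier_vecD)
  qed
  then show ?thesis using assms by (simp add: fiber_eq_translate card_image)
qed

lemma a_rcosets_kernel:
  fixes H :: "'a::{field,finite} mat"
  assumes "H \<in> carrier_mat r n"
  shows "a_rcosets\<^bsub>module_vec TYPE('a) n\<^esub> (mat_kernel H) = fiber H ` ((*\<^sub>v) H ` carrier_vec n)"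
proof -
  have "a_rcosets\<^bsub>module_vec TYPE('a) n\<^esub> (mat_kernel H)
      = (\<lambda>x. (\<lambda>c. c + x) ` mat_kernel H) ` carrier_vec n"
    by (auto simp: A_RCOSETS_def RCOSETS_def r_coset_def module_vec_def)
  then show ?thesis using assms by (simp add: image_image fiber_eq_translate)
qed

lemma num_cosets_kernel:
  fixes H :: "'a::{field,finite} mat"
  assumes "H \<in> carrier_mat r n"
  shows "num_cosets n w (mat_kernel H) =
    card {s \<in> (*\<^sub>v) H ` carrier_vec n. coset_weight (fiber H s) = w}"
proof -
  \<comment> \<open>Attained syndromes have nonempty fibers, and any member of a fiber recovers its
    syndrome.\<close>
  have "inj_on (fiber H) ((*\<^sub>v) H ` carrier_vec n)"
    using assms by (intro inj_onI) (auto simp: fiber_def)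
  then have "inj_on (fiber H) {s \<in> (*\<^sub>v) H ` carrier_vec n. coset_weight (fiber H s) = w}"
    by (rule inj_on_subset) auto
  moreover have "{K \<in> a_rcosets\<^bsub>module_vec TYPE('a) n\<^esub> (mat_kernel H). coset_weight K = w}
      = fiber H ` {s \<in> (*\<^sub>v) H ` carrier_vec n. coset_weight (fiber H s) = w}"
    unfolding a_rcosets_kernel[OF assms] by auto
  ultimately show ?thesis by (simp add: num_cosets_def card_image)
qed

text \<open>As \<open>c\<close> runs through the code, \<open>v - c\<close> runs through the whole
  coset of \<open>v\<close>; this turns distance to the code into coset weight.\<close>

lemma hamming_dist_image_kernel:
  fixes H :: "'a::{field,finite} mat"
  assumes H: "H \<in> carrier_mat r n" and v: "v \<in> carrier_vec n"
  shows "hamming_dist v ` mat_kernel H = hamming_weight ` fiber H (H *\<^sub>v v)"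
proof -
  have "(\<lambda>c. v - c) ` mat_kernel H = fiber H (H *\<^sub>v v)"
  proof (intro Set.set_eqI iffI)
    fix y assume "y \<in> (\<lambda>c. v - c) ` mat_kernel H"
    then obtain c where c: "c \<in> mat_kernel H" "y = v - c" by blast
    then show "y \<in> fiber H (H *\<^sub>v v)"
      using mat_kernelD[OF H c(1)] H v by (simp add: fiber_def mult_minus_distrib_mat_vec)
  next
    fix y assume "y \<in> fiber H (H *\<^sub>v v)"
    then have y: "y \<in> carrier_vec n" "H *\<^sub>v y = H *\<^sub>v v" using H by (auto simp: fiber_def)
    then have "v - y \<in> mat_kernel H" using H v by (intro mat_kernelI[OF H]) (auto simp: mult_minus_distrib_mat_vec)
    moreover have "y = v - (v - y)" using v y by (intro eq_vecI) auto
    ultimately show "y \<in> (\<lambda>c. v - c) ` mat_kernel H" by blast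
  qed
  moreover have "hamming_dist v ` mat_kernel H = hamming_weight ` (\<lambda>c. v - c) ` mat_kernel H"
    unfolding image_image
    using v mat_kernel_carrier[OF H] by (intro image_cong) (auto simp: hamming_dist_minus)
  ultimately show ?thesis by simp
qed

lemma dist_to_code_kernel:
  fixes H :: "'a::{field,finite} mat"
  assumes "H \<in> carrier_mat r n" "v \<in> carrier_vec n"
  shows "dist_to_code (mat_kernel H) v = coset_weight (fiber H (H *\<^sub>v v))"
  using assms by (simp add: dist_to_code_def coset_weight_def hamming_dist_image_kernel)

lemma coset_weight_le:
  assumes "x \<in> K"
  shows "coset_weight K \<le> hamming_weight x"
  using assms by (auto simp: coset_weight_def intro: cInf_lower)

lemma coset_weight_attained:
  assumes "K \<noteq> {}"
  obtains x where "x \<in> K" "hamming_weight x = coset_weight K"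
proof -
  have "Inf (hamming_weight ` K) \<in> hamming_weight ` K"
    using assms by (intro Inf_nat_def1) auto
  then show thesis using that by (auto simp: coset_weight_def)
qed

lemma covering_radius_kernel:
  fixes H :: "'a::{field,finite} mat"
  assumes H: "H \<in> carrier_mat r n"
    and le: "\<And>v. v \<in> carrier_vec n \<Longrightarrow> coset_weight (fiber H (H *\<^sub>v v)) \<le> R"
    and w: "w \<in> carrier_vec n" "coset_weight (fiber H (H *\<^sub>v w)) = R"
  shows "covering_radius n (mat_kernel H) = R"
proof -
  have ex_iff: "(\<exists>c \<in> mat_kernel H. hamming_dist v c \<le> R') \<longleftrightarrow> coset_weight (fiber H (H *\<^sub>v v)) \<le> R'"
    if v: "v \<in> carrier_vec n" for v R'
  proof -
    have "(\<exists>c \<in> mat_kernel H. hamming_dist v c \<le> R') \<longleftrightarrow> (\<exists>m \<in> hamming_dist v ` mat_kernel H. m \<le> R')"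
      by auto
    also have "\<dots> \<longleftrightarrow> (\<exists>x \<in> fiber H (H *\<^sub>v v). hamming_weight x \<le> R')"
      unfolding hamming_dist_image_kernel[OF H v] by auto
    also have "\<dots> \<longleftrightarrow> coset_weight (fiber H (H *\<^sub>v v)) \<le> R'"
    proof
      assume "coset_weight (fiber H (H *\<^sub>v v)) \<le> R'"
      moreover have "fiber H (H *\<^sub>v v) \<noteq> {}" using v H by (auto simp: fiber_def)
      ultimately show "\<exists>x \<in> fiber H (H *\<^sub>v v). hamming_weight x \<le> R'"
        by (metis coset_weight_attained)
    qed (use coset_weight_le order_trans in blast)
    finally show ?thesis .
  qed
  show ?thesis
    unfolding covering_radius_def
  proof (rule Least_equality)
    show "\<forall>v\<in>carrier_vec n. \<exists>c\<in>mat_kernel H. hamming_dist v c \<le> R" using ex_iff le by blast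
  next
    fix R' assume "\<forall>v\<in>carrier_vec n. \<exists>c\<in>mat_kernel H. hamming_dist v c \<le> R'"
    then show "R \<le> R'" using ex_iff w by blast
  qed
qed

lemma card_preimage_syndromes:
  fixes H :: "'a::{field,finite} mat"
  assumes "H \<in> carrier_mat r n" "S \<subseteq> (*\<^sub>v) H ` carrier_vec n"
  shows "card {x \<in> carrier_vec n. H *\<^sub>v x \<in> S} = card (mat_kernel H) * card S"
proof -
  have finS: "finite S" using assms(2) by (rule finite_subset) simp
  have "{x \<in> carrier_vec n. H *\<^sub>v x \<in> S} = (\<Union>s\<in>S. fiber H s)"
    using assms(1) by (auto simp: fiber_def)
  also have "card \<dots> = (\<Sum>s\<in>S. card (fiber H s))"
    using finS by (intro card_UN_disjoint) (auto simp: fiber_def intro!: finite_subset[OF _ finite_carrier_vec])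
  also have "\<dots> = (\<Sum>s\<in>S. card (mat_kernel H))"
    using assms(2) card_fiber[OF assms(1)] by (intro sum.cong) (auto simp del: index_mult_mat_vec)
  finally show ?thesis by simp
qed

text \<open>Distance to the code depends on the syndrome alone, so the deep holes fill whole cosets,
  each with as many vectors as the kernel.\<close>

lemma card_deep_holes_kernel:
  fixes H :: "'a::{field,finite} mat"
  assumes H: "H \<in> carrier_mat r n"
  shows "card (deep_holes n (mat_kernel H)) =
    card (mat_kernel H) * num_cosets n (covering_radius n (mat_kernel H)) (mat_kernel H)"
proof -
  let ?S = "{s \<in> (*\<^sub>v) H ` carrier_vec n.
    coset_weight (fiber H s) = covering_radius n (mat_kernel H)}"
  have "deep_holes n (mat_kernel H) = {x \<in> carrier_vec n. H *\<^sub>v x \<in> ?S}"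
    using H by (auto simp: deep_holes_def dist_to_code_kernel)
  then show ?thesis
    using card_preimage_syndromes[OF H, of ?S] by (simp add: num_cosets_kernel[OF H])
qed

lemma dim_mat_kernel_surj:
  fixes H :: "'a::{field,finite} mat"
  assumes H: "H \<in> carrier_mat r n" and surj: "(*\<^sub>v) H ` carrier_vec n = carrier_vec r"
  shows "r + vectorspace.dim class_ring ((module_vec TYPE('a) n)\<lparr>carrier := mat_kernel H\<rparr>) = n"
proof -
  interpret V: vec_space "TYPE('a)" n .
  interpret W: vec_space "TYPE('a)" r .
  interpret lin: linear_map class_ring "module_vec TYPE('a) n" "module_vec TYPE('a) r" "(*\<^sub>v) H"
  proof unfold_locales
    show "(*\<^sub>v) H \<in> LinearCombinations.module_hom class_ring (module_vec TYPE('a) n) (module_vec TYPE('a) r)"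
      using H by (auto simp: LinearCombinations.module_hom_def module_vec_simps mult_add_distrib_mat_vec class_ring_simps)
  qed
  have im: "lin.imT = carrier_vec r" using surj by (simp add: lin.im_def module_vec_simps)
  have ker: "lin.kerT = mat_kernel H" using H by (auto simp: lin.ker_def module_vec_simps mat_kernel)
  have Wr: "W.vs (carrier_vec r) = module_vec TYPE('a) r" by (simp add: module_vec_def)
  show ?thesis
    using lin.rank_nullity[OF V.fin_dim] unfolding im ker V.dim_is_n Wr W.dim_is_n .
qed

lemma subspace_mat_kernel:
  fixes H :: "'a::{field,finite} mat"
  assumes H: "H \<in> carrier_mat r n"
  shows "VectorSpace.subspace class_ring (mat_kernel H) (module_vec TYPE('a) n)"
proof -
  interpret V: vec_space "TYPE('a)" n .
  show ?thesis
  proof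
    show "mat_kernel H \<subseteq> carrier (module_vec TYPE('a) n)"
      using mat_kernel_carrier[OF H] by (simp add: module_vec_simps)
  qed (use H in \<open>auto simp: module_vec_simps mat_kernel mult_add_distrib_mat_vec mult_mat_vec class_ring_simps\<close>)
qed

section \<open>Parity check matrices with columns in general position\<close>

text \<open>Linear independence of any at most \<open>dim_row H\<close> columns, put as the absence
  of short nonzero kernel words. It stays meaningful when the kernel is trivial, where
  \<open>min_distance\<close> is 0.\<close>

definition general_position :: "'a::field mat \<Rightarrow> bool" where
  "general_position H \<longleftrightarrow>
     (\<forall>v \<in> mat_kernel H. hamming_weight v \<le> dim_row H \<longrightarrow> v = 0\<^sub>v (dim_col H))"

lemma general_positionD:
  assumes H: "H \<in> carrier_mat r n" "general_position H"
    and v: "v \<in> carrier_vec n" "H *\<^sub>v v = 0\<^sub>v r" "hamming_weight v \<le> r"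
  shows "v = 0\<^sub>v n"
proof -
  have "dim_row H = r" "dim_col H = n" using H(1) by auto
  with mat_kernelI[OF H(1) v(1,2)] H(2) v(3) show ?thesis
    unfolding general_position_def by blast
qed

text \<open>The difference of the two words is a kernel word supported on the union of their
  supports. Most later uniqueness claims reduce to counting the columns in such a union.\<close>

lemma general_position_inj:
  fixes H :: "'a::{field,finite} mat"
  assumes H: "H \<in> carrier_mat r n" "general_position H"
    and v: "v \<in> carrier_vec n" and w: "w \<in> carrier_vec n"
    and eq: "H *\<^sub>v v = H *\<^sub>v w"
    and supp: "card (supp v \<union> supp w) \<le> r"
  shows "v = w"
proof -
  have "H *\<^sub>v (v - w) = 0\<^sub>v r"
    using H(1) w by (simp add: mult_minus_distrib_mat_vec[OF H(1) v w] eq)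
  moreover have "hamming_weight (v - w) \<le> r"
    using card_mono[OF _ supp_minus[OF v w]] supp by (simp add: hamming_weight_supp)
  ultimately have "v - w = 0\<^sub>v n" using general_positionD[OF H, of "v - w"] v w by simp
  then show ?thesis using vec_minus_eq_0_iff[OF v w] by simp
qed

text \<open>The map is injective on the \<open>q ^ r\<close> words supported in \<open>J\<close>,
  and there are \<open>q ^ r\<close> vectors of length \<open>r\<close>, so it is onto.\<close>

lemma general_position_span:
  fixes H :: "'a::{field,finite} mat"
  assumes H: "H \<in> carrier_mat r n" "general_position H"
    and J: "J \<subseteq> {..<n}" "card J = r" and s: "s \<in> carrier_vec r"
  obtains v where "v \<in> carrier_vec n" "supp v \<subseteq> J" "H *\<^sub>v v = s"
proof -
  let ?V = "{v \<in> carrier_vec n. supp v \<subseteq> J} :: 'a vec set"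
  have fin: "finite J" using J(1) finite_subset by blast
  have "inj_on ((*\<^sub>v) H) ?V"
  proof (rule inj_onI)
    fix v w assume vw: "v \<in> ?V" "w \<in> ?V" "H *\<^sub>v v = H *\<^sub>v w"
    then have "supp v \<union> supp w \<subseteq> J" by blast
    then have "card (supp v \<union> supp w) \<le> r" using card_mono[OF fin] J(2) by blast
    with general_position_inj[OF H, of v w] vw show "v = w" by blast
  qed
  then have "card ((*\<^sub>v) H ` ?V) = card (carrier_vec r :: 'a vec set)"
    using J by (simp add: card_image card_vecs_supported card_carrier_vec)
  moreover have "(*\<^sub>v) H ` ?V \<subseteq> carrier_vec r" using H by auto
  ultimately have "(*\<^sub>v) H ` ?V = carrier_vec r" by (intro card_subset_eq) auto
  with s have "s \<in> (*\<^sub>v) H ` ?V" by simp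
  then show thesis using that by auto
qed

lemma general_position_surj:
  fixes H :: "'a::{field,finite} mat"
  assumes H: "H \<in> carrier_mat r n" "general_position H" and "r \<le> n"
  shows "(*\<^sub>v) H ` carrier_vec n = carrier_vec r"
proof
  show "(*\<^sub>v) H ` carrier_vec n \<subseteq> carrier_vec r" using H by auto
  show "carrier_vec r \<subseteq> (*\<^sub>v) H ` carrier_vec n"
    using general_position_span[OF H, of "{..<r}"] \<open>r \<le> n\<close>
    by (metis card_lessThan image_eqI lessThan_subset_iff subsetI)
qed

lemma card_mat_kernel_general_position:
  fixes H :: "'a::{field,finite} mat"
  assumes H: "H \<in> carrier_mat r n" "general_position H" and "r \<le> n"
  shows "card (mat_kernel H) = CARD('a) ^ (n - r)"
proof -
  have "card {x \<in> carrier_vec n. H *\<^sub>v x \<in> carrier_vec r} = card (mat_kernel H) * CARD('a) ^ r"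
    using card_preimage_syndromes[OF H(1), of "carrier_vec r"] general_position_surj[OF assms]
    by (simp add: card_carrier_vec)
  moreover have "{x \<in> carrier_vec n. H *\<^sub>v x \<in> carrier_vec r} = carrier_vec n" using H by auto
  ultimately have "card (mat_kernel H) * CARD('a) ^ r = CARD('a) ^ (n - r) * CARD('a) ^ r"
    using \<open>r \<le> n\<close> by (simp add: card_carrier_vec flip: power_add)
  then show ?thesis by simp
qed

text \<open>General position excludes distances up to \<open>r\<close>. Distance
  \<open>r + 1\<close> occurs since the \<open>q ^ (r + 1)\<close> words on the first
  \<open>r + 1\<close> coordinates share \<open>q ^ r\<close> syndromes; \<open>r < n\<close>
  provides the extra coordinate.\<close>

lemma min_distance_general_position:
  fixes H :: "'a::{field,finite} mat"
  assumes H: "H \<in> carrier_mat r n" "general_position H" and "r < n"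
  shows "min_distance (mat_kernel H) = r + 1"
proof -
  let ?W = "{hamming_dist x y | x y. x \<in> mat_kernel H \<and> y \<in> mat_kernel H \<and> x \<noteq> y}"
  have lower: "r + 1 \<le> m" if "m \<in> ?W" for m
  proof (rule ccontr)
    assume small: "\<not> r + 1 \<le> m"
    from that obtain x y where xy: "x \<in> mat_kernel H" "y \<in> mat_kernel H" "x \<noteq> y"
      and m: "m = hamming_dist x y" by blast
    have c: "x \<in> carrier_vec n" "y \<in> carrier_vec n" and "H *\<^sub>v x = 0\<^sub>v r" "H *\<^sub>v y = 0\<^sub>v r"
      using xy mat_kernelD[OF H(1)] by auto
    then have "H *\<^sub>v (x - y) = 0\<^sub>v r" by (simp add: mult_minus_distrib_mat_vec[OF H(1) c])
    moreover have "hamming_weight (x - y) \<le> r" using small m c by (simp add: hamming_dist_minus[OF c])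
    ultimately have "x - y = 0\<^sub>v n" using general_positionD[OF H, of "x - y"] c by simp
    then show False using vec_minus_eq_0_iff[OF c] xy(3) by simp
  qed
  let ?J = "{..<r + 1}"
  let ?V = "{v \<in> carrier_vec n. supp v \<subseteq> ?J} :: 'a vec set"
  have J: "?J \<subseteq> {..<n}" using \<open>r < n\<close> by auto
  have "1 < CARD('a)" using card_mono[of UNIV "{0, 1 :: 'a}"] by simp
  then have "card (carrier_vec r :: 'a vec set) < card ?V"
    using card_vecs_supported[OF J, where 'a = 'a] by (simp add: card_carrier_vec)
  then have "\<not> inj_on ((*\<^sub>v) H) ?V"
  proof -
    have "(*\<^sub>v) H ` ?V \<subseteq> carrier_vec r" using H(1) by auto
    then have "card ?V \<le> card (carrier_vec r :: 'a vec set)" if "inj_on ((*\<^sub>v) H) ?V"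
      using card_inj_on_le[OF that] by simp
    moreover assume "card (carrier_vec r :: 'a vec set) < card ?V"
    ultimately show ?thesis by linarith
  qed
  then obtain v w where vw: "v \<in> ?V" "w \<in> ?V" "H *\<^sub>v v = H *\<^sub>v w" "v \<noteq> w"
    unfolding inj_on_def by blast
  then have v: "v \<in> carrier_vec n" and w: "w \<in> carrier_vec n" by simp_all
  have "H *\<^sub>v (v - w) = 0\<^sub>v r"
    using H(1) w by (simp add: mult_minus_distrib_mat_vec[OF H(1) v w] vw(3))
  then have "v - w \<in> mat_kernel H" using v w by (intro mat_kernelI[OF H(1)]) simp_all
  moreover have "0\<^sub>v n \<in> mat_kernel H" using H by (intro mat_kernelI[OF H(1)]) auto
  moreover have "v - w \<noteq> 0\<^sub>v n" using vw vec_minus_eq_0_iff[OF v w] by simp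
  ultimately have mem: "hamming_dist (v - w) (0\<^sub>v n) \<in> ?W" by blast
  have "supp (v - w) \<subseteq> ?J" using supp_minus[OF v w] vw by blast
  then have "hamming_weight (v - w) \<le> r + 1"
    using card_mono[of ?J] by (simp add: hamming_weight_supp)
  moreover have "hamming_dist (v - w) (0\<^sub>v n) = hamming_weight (v - w)"
    using hamming_dist_minus[of "v - w" n "0\<^sub>v n"] v w by simp
  ultimately have "r + 1 \<in> ?W" using lower[OF mem] mem by simp
  then show ?thesis
    unfolding min_distance_def by (intro cInf_eq_minimum) (use lower in auto)
qed

lemma mds_code_general_position:
  fixes H :: "'a::{field,finite} mat"
  assumes H: "H \<in> carrier_mat r n" "general_position H" and "r < n"
  shows "mds_code n (n - r) (r + 1) (mat_kernel H)"
  using dim_mat_kernel_surj[OF H(1) general_position_surj[OF H]] subspace_mat_kernel[OF H(1)]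
    min_distance_general_position[OF assms] \<open>r < n\<close>
  by (simp add: mds_code_def linear_code_def)

lemma general_position_of_min_distance:
  fixes H :: "'a::{field,finite} mat"
  assumes H: "H \<in> carrier_mat r n" and d: "min_distance (mat_kernel H) = r + 1"
  shows "general_position H"
  unfolding general_position_def
proof (intro ballI impI)
  fix v assume v: "v \<in> mat_kernel H" and wt: "hamming_weight v \<le> dim_row H"
  show "v = 0\<^sub>v (dim_col H)"
  proof (rule ccontr)
    assume nz: "v \<noteq> 0\<^sub>v (dim_col H)"
    have vc: "v \<in> carrier_vec n" using mat_kernelD[OF H v] by simp
    have "0\<^sub>v n \<in> mat_kernel H" using H by (intro mat_kernelI[OF H]) auto
    then have "min_distance (mat_kernel H) \<le> hamming_dist v (0\<^sub>v n)"
      unfolding min_distance_def using v nz H by (intro cInf_lower) auto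
    also have "\<dots> = hamming_weight v"
      using hamming_dist_minus[of v n "0\<^sub>v n"] vc by simp
    finally show False using d wt H by simp
  qed
qed

text \<open>That \<open>s\<close> is attained matters: the \<open>coset_weight\<close> of an empty
  fiber is \<open>Inf {} = 0\<close>, which would satisfy the left side for every
  \<open>w\<close>.\<close>

lemma coset_weight_fiber_le_iff:
  fixes H :: "'a::{field,finite} mat"
  assumes H: "H \<in> carrier_mat r n" and s: "s \<in> (*\<^sub>v) H ` carrier_vec n"
  shows "coset_weight (fiber H s) \<le> w \<longleftrightarrow>
    (\<exists>v \<in> carrier_vec n. hamming_weight v \<le> w \<and> H *\<^sub>v v = s)"
proof
  have ne: "fiber H s \<noteq> {}" using s H by (auto simp: fiber_def)
  assume "coset_weight (fiber H s) \<le> w"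
  with ne obtain x where "x \<in> fiber H s" "hamming_weight x \<le> w" by (metis coset_weight_attained)
  then show "\<exists>v \<in> carrier_vec n. hamming_weight v \<le> w \<and> H *\<^sub>v v = s" using H by (auto simp: fiber_def)
next
  assume "\<exists>v \<in> carrier_vec n. hamming_weight v \<le> w \<and> H *\<^sub>v v = s"
  then obtain v where "v \<in> fiber H s" "hamming_weight v \<le> w" using H by (auto simp: fiber_def)
  then show "coset_weight (fiber H s) \<le> w" using coset_weight_le order_trans by blast
qed

section \<open>Deleting columns of a parity check matrix\<close>

lemma remove_cols_carrier:
  assumes "H \<in> carrier_mat r n" "D \<subseteq> {..<n}"
  shows "remove_cols H D \<in> carrier_mat r (n - card D)"
proof -
  have "{j. j < n \<and> j \<in> - D} = {..<n} - D" by auto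
  then have "card {j. j < n \<and> j \<in> - D} = n - card D"
    using assms(2) by (simp add: card_Diff_subset finite_subset)
  then show ?thesis using assms(1) by (intro carrier_matI) (auto simp: remove_cols_def dim_submatrix)
qed

text \<open>\<open>D\<close> is finite, so \<open>- D\<close> is infinite and
  \<open>pick (- D)\<close> enumerates it without end; exactly the first \<open>n - card D\<close>
  values fall below \<open>n\<close>.\<close>

lemma bij_betw_pick:
  fixes D :: "nat set"
  assumes "D \<subseteq> {..<n}"
  shows "bij_betw (pick (- D)) {..<n - card D} ({..<n} - D)"
proof -
  have fin: "finite D" using assms finite_subset by blast
  then have inf: "infinite (- D)" by (simp add: Compl_eq_Diff_UNIV)
  have c: "card ({..<n} - D) = n - card D" using assms fin by (simp add: card_Diff_subset)
  have "{a. a < n \<and> a \<in> - D} = {..<n} - D" by auto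
  then have less: "pick (- D) i < n" if "i < n - card D" for i
    using that c by (intro pick_le) simp
  have inj: "inj_on (pick (- D)) {..<n - card D}"
    using pick_eq_iff_inf[OF inf] by (auto simp: inj_on_def)
  moreover have "pick (- D) ` {..<n - card D} = {..<n} - D"
    using less pick_in_set_inf[OF inf] inj c
    by (intro card_subset_eq) (auto simp: card_image)
  ultimately show ?thesis by (simp add: bij_betw_def)
qed

text \<open>\<open>\<phi>\<close> drops the coordinates in \<open>D\<close>, on which these words
  vanish. Syndrome and weight survive, so coset weights of the smaller code can be computed with
  words of length \<open>n\<close> and the original columns.\<close>

lemma remove_cols_transfer:
  fixes H :: "'a::{field,finite} mat"
  assumes H: "H \<in> carrier_mat r n" and D: "D \<subseteq> {..<n}"
  obtains \<phi> where "bij_betw \<phi> {v \<in> carrier_vec n. supp v \<inter> D = {}} (carrier_vec (n - card D))"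
    "\<And>v. v \<in> carrier_vec n \<Longrightarrow> supp v \<inter> D = {} \<Longrightarrow> remove_cols H D *\<^sub>v \<phi> v = H *\<^sub>v v"
    "\<And>v. v \<in> carrier_vec n \<Longrightarrow> supp v \<inter> D = {} \<Longrightarrow> hamming_weight (\<phi> v) = hamming_weight v"
proof
  let ?m = "n - card D"
  let ?f = "pick (- D)"
  let ?g = "the_inv_into {..<?m} ?f"
  let ?\<phi> = "\<lambda>v. vec ?m (\<lambda>i. v $ ?f i)"
  have bij: "bij_betw ?f {..<?m} ({..<n} - D)" by (rule bij_betw_pick[OF D])
  have f: "?f i < n" "?f i \<notin> D" if "i < ?m" for i
    using bij_betwE[OF bij] that by auto
  have g: "?g k < ?m" "?f (?g k) = k" if "k < n" "k \<notin> D" for k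
    using bij_betwE[OF bij_betw_the_inv_into[OF bij]] f_the_inv_into_f_bij_betw[OF bij] that by auto
  have gf: "?g (?f i) = i" if "i < ?m" for i
    using the_inv_into_f_f[OF bij_betw_imp_inj_on[OF bij]] that by auto
  show "bij_betw ?\<phi> {v \<in> carrier_vec n. supp v \<inter> D = {}} (carrier_vec ?m)"
  proof (rule bij_betw_byWitness[where f' = "\<lambda>v. vec n (\<lambda>k. if k \<in> D then 0 else v $ ?g k)"])
    show "\<forall>a\<in>{v \<in> carrier_vec n. supp v \<inter> D = {}}.
        vec n (\<lambda>k. if k \<in> D then 0 else ?\<phi> a $ ?g k) = a"
      using g by (auto intro!: eq_vecI simp: supp_def)
    show "\<forall>a'\<in>carrier_vec ?m. ?\<phi> (vec n (\<lambda>k. if k \<in> D then 0 else a' $ ?g k)) = a'"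
      using f gf by (auto intro!: eq_vecI)
  qed (auto simp: supp_def)
  fix v :: "'a vec" assume v: "v \<in> carrier_vec n" and vD: "supp v \<inter> D = {}"
  have "?f ` supp (?\<phi> v) = supp v"
  proof
    show "?f ` supp (?\<phi> v) \<subseteq> supp v" using f v by (auto simp: supp_def)
    show "supp v \<subseteq> ?f ` supp (?\<phi> v)"
    proof
      fix k assume k: "k \<in> supp v"
      then have "k < n" "k \<notin> D" using v vD by (auto simp: supp_def)
      then have "?g k \<in> supp (?\<phi> v)" using g k by (auto simp: supp_def)
      then show "k \<in> ?f ` supp (?\<phi> v)" using g \<open>k < n\<close> \<open>k \<notin> D\<close> by (metis image_eqI)
    qed
  qed
  moreover have "inj_on ?f (supp (?\<phi> v))"
    by (rule inj_on_subset[OF bij_betw_imp_inj_on[OF bij]]) (auto simp: supp_def)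
  ultimately show "hamming_weight (?\<phi> v) = hamming_weight v"
    by (metis card_image hamming_weight_supp)
  have H': "remove_cols H D \<in> carrier_mat r ?m" by (rule remove_cols_carrier[OF H D])
  have "{j. j < n \<and> j \<in> - D} = {..<n} - D" by auto
  then have card_m: "card {j. j < n \<and> j \<in> - D} = ?m"
    using D by (simp add: card_Diff_subset finite_subset)
  have entry: "remove_cols H D $$ (i, j) = H $$ (i, ?f j)" if "i < r" "j < ?m" for i j
    using that H card_m by (simp add: remove_cols_def submatrix_index pick_UNIV)
  show "remove_cols H D *\<^sub>v ?\<phi> v = H *\<^sub>v v"
  proof (rule eq_vecI)
    fix i assume "i < dim_vec (H *\<^sub>v v)"
    then have i: "i < r" using H by simp
    have "(remove_cols H D *\<^sub>v ?\<phi> v) $ i = (\<Sum>j<?m. H $$ (i, ?f j) * v $ ?f j)"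
      using i H' by (auto simp: scalar_prod_def entry atLeast0LessThan intro!: sum.cong)
    also have "\<dots> = (\<Sum>k\<in>{..<n} - D. H $$ (i, k) * v $ k)"
      by (rule sum.reindex_bij_betw[OF bij])
    also have "\<dots> = (\<Sum>k<n. H $$ (i, k) * v $ k)"
      using v vD by (intro sum.mono_neutral_left) (auto simp: supp_def)
    also have "\<dots> = (H *\<^sub>v v) $ i"
      using i H v by (auto simp: scalar_prod_def atLeast0LessThan intro!: sum.cong)
    finally show "(remove_cols H D *\<^sub>v ?\<phi> v) $ i = (H *\<^sub>v v) $ i" .
  qed (use H H' in auto)
qed

lemma general_position_remove_cols:
  fixes H :: "'a::{field,finite} mat"
  assumes H: "H \<in> carrier_mat r n" "general_position H" and D: "D \<subseteq> {..<n}"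
  shows "general_position (remove_cols H D)"
  unfolding general_position_def
proof (intro ballI impI)
  let ?H' = "remove_cols H D"
  have H': "?H' \<in> carrier_mat r (n - card D)" by (rule remove_cols_carrier[OF H(1) D])
  fix y assume y: "y \<in> mat_kernel ?H'" and wt: "hamming_weight y \<le> dim_row ?H'"
  obtain \<phi> where bij: "bij_betw \<phi> {v \<in> carrier_vec n. supp v \<inter> D = {}} (carrier_vec (n - card D))"
    and mult: "\<And>v. v \<in> carrier_vec n \<Longrightarrow> supp v \<inter> D = {} \<Longrightarrow> ?H' *\<^sub>v \<phi> v = H *\<^sub>v v"
    and weight: "\<And>v. v \<in> carrier_vec n \<Longrightarrow> supp v \<inter> D = {} \<Longrightarrow> hamming_weight (\<phi> v) = hamming_weight v"
    using remove_cols_transfer[OF H(1) D] by blast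
  have yc: "y \<in> carrier_vec (n - card D)" and y0: "?H' *\<^sub>v y = 0\<^sub>v r"
    using mat_kernelD[OF H' y] by auto
  then obtain v where v: "v \<in> carrier_vec n" "supp v \<inter> D = {}" "y = \<phi> v"
    using bij_betw_imp_surj_on[OF bij] by blast
  have "H *\<^sub>v v = 0\<^sub>v r" using v mult y0 by simp
  moreover have "hamming_weight v \<le> r" using wt H' v weight by simp
  ultimately have "v = 0\<^sub>v n" using general_positionD[OF H v(1)] by simp
  then have "supp v = {}" by (simp add: supp_def)
  then have "card (supp y) = 0" using weight[OF v(1,2)] v(3) by (simp add: hamming_weight_supp)
  then have "supp y = {}" by simp
  then show "y = 0\<^sub>v (dim_col ?H')" using supp_empty_iff[OF yc] H' by simp
qed

text \<open>At least \<open>r\<close> columns survive, so every vector of length \<open>r\<close>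
  remains a syndrome of the smaller matrix.\<close>

lemma coset_weight_remove_cols_le_iff:
  fixes H :: "'a::{field,finite} mat"
  assumes H: "H \<in> carrier_mat r n" "general_position H" and D: "D \<subseteq> {..<n}"
    and "r + card D \<le> n" and s: "s \<in> carrier_vec r"
  shows "coset_weight (fiber (remove_cols H D) s) \<le> w \<longleftrightarrow>
    (\<exists>v \<in> carrier_vec n. supp v \<inter> D = {} \<and> hamming_weight v \<le> w \<and> H *\<^sub>v v = s)"
proof -
  let ?H' = "remove_cols H D"
  have H': "?H' \<in> carrier_mat r (n - card D)" by (rule remove_cols_carrier[OF H(1) D])
  obtain \<phi> where bij: "bij_betw \<phi> {v \<in> carrier_vec n. supp v \<inter> D = {}} (carrier_vec (n - card D))"
    and mult: "\<And>v. v \<in> carrier_vec n \<Longrightarrow> supp v \<inter> D = {} \<Longrightarrow> ?H' *\<^sub>v \<phi> v = H *\<^sub>v v"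
    and weight: "\<And>v. v \<in> carrier_vec n \<Longrightarrow> supp v \<inter> D = {} \<Longrightarrow> hamming_weight (\<phi> v) = hamming_weight v"
    using remove_cols_transfer[OF H(1) D] by blast
  have "s \<in> (*\<^sub>v) ?H' ` carrier_vec (n - card D)"
    using general_position_surj[OF H' general_position_remove_cols[OF H D]] \<open>r + card D \<le> n\<close> s by simp
  then have "coset_weight (fiber ?H' s) \<le> w \<longleftrightarrow>
    (\<exists>y \<in> \<phi> ` {v \<in> carrier_vec n. supp v \<inter> D = {}}. hamming_weight y \<le> w \<and> ?H' *\<^sub>v y = s)"
    by (simp only: coset_weight_fiber_le_iff[OF H'] bij_betw_imp_surj_on[OF bij])
  also have "\<dots> \<longleftrightarrow> (\<exists>v \<in> carrier_vec n. supp v \<inter> D = {} \<and> hamming_weight v \<le> w \<and> H *\<^sub>v v = s)"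
    using mult weight by auto
  finally show ?thesis .
qed

section \<open>Syndromes proportional to a removed column\<close>

lemma mult_smult_unit_vec:
  fixes H :: "'a::{field,finite} mat"
  assumes H: "H \<in> carrier_mat r n" and j: "j < n"
  shows "H *\<^sub>v (a \<cdot>\<^sub>v unit_vec n j) = a \<cdot>\<^sub>v col H j"
  using H j by (intro eq_vecI) auto

lemma supp_smult_unit_vec: "supp (a \<cdot>\<^sub>v unit_vec n j :: 'a::field vec) \<subseteq> {j}"
  by (auto simp: supp_def unit_vec_def split: if_splits)

lemma scaled_col_inj:
  fixes H :: "'a::{field,finite} mat"
  assumes H: "H \<in> carrier_mat r n" "general_position H" and r: "2 \<le> r"
    and ij: "i < n" "j < n" and a: "a \<noteq> 0" and eq: "a \<cdot>\<^sub>v col H i = b \<cdot>\<^sub>v col H j"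
  shows "i = j \<and> a = b"
proof -
  let ?v = "a \<cdot>\<^sub>v unit_vec n i" and ?w = "b \<cdot>\<^sub>v unit_vec n j"
  have "supp ?v \<union> supp ?w \<subseteq> {i, j}" using supp_smult_unit_vec by blast
  then have "card (supp ?v \<union> supp ?w) \<le> card {i, j}" by (intro card_mono) auto
  also have "\<dots> \<le> r" using r by (simp add: card_insert_if)
  finally have "?v = ?w"
    using general_position_inj[OF H, of ?v ?w] eq ij by (simp add: mult_smult_unit_vec[OF H(1)])
  then have "?v $ i = ?w $ i" by simp
  then show ?thesis using ij a by (auto simp: unit_vec_def split: if_splits)
qed

text \<open>Origin of \<open>(q - 1) * card D\<close>: distinct pairs of a nonzero scalar and a
  removed column give distinct syndromes.\<close>

lemma card_scaled_cols:
  fixes H :: "'a::{field,finite} mat"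
  assumes H: "H \<in> carrier_mat r n" "general_position H" and r: "2 \<le> r" and D: "D \<subseteq> {..<n}"
  shows "card {a \<cdot>\<^sub>v col H j | a j. a \<noteq> 0 \<and> j \<in> D} = (CARD('a) - 1) * card D"
proof -
  let ?f = "\<lambda>(a, j). a \<cdot>\<^sub>v col H j"
  have "inj_on ?f ((UNIV - {0}) \<times> D)"
  proof (rule inj_onI)
    fix x y assume xy: "x \<in> (UNIV - {0}) \<times> D" "y \<in> (UNIV - {0}) \<times> D" "?f x = ?f y"
    obtain a i b j where "x = (a, i)" "y = (b, j)" by (cases x, cases y)
    then show "x = y" using scaled_col_inj[OF H r, of i j a b] xy D by auto
  qed
  moreover have "{a \<cdot>\<^sub>v col H j | a j. a \<noteq> 0 \<and> j \<in> D} = ?f ` ((UNIV - {0}) \<times> D)"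
    by (auto simp: image_iff)
  ultimately show ?thesis by (simp add: card_image card_cartesian_product)
qed

text \<open>If \<open>v\<close> had weight below \<open>r\<close>, then \<open>v\<close> and the
  one-coordinate word at \<open>j\<close> would together use at most \<open>r\<close> columns and
  hence be equal, although \<open>v\<close> vanishes on \<open>D\<close>.\<close>

lemma weight_of_removed_col:
  fixes H :: "'a::{field,finite} mat"
  assumes H: "H \<in> carrier_mat r n" "general_position H" and j: "j < n" "j \<in> D" and a: "a \<noteq> 0"
    and v: "v \<in> carrier_vec n" "supp v \<inter> D = {}" and eq: "H *\<^sub>v v = a \<cdot>\<^sub>v col H j"
  shows "r \<le> hamming_weight v"
proof (rule ccontr)
  let ?w = "a \<cdot>\<^sub>v unit_vec n j :: 'a vec"
  assume "\<not> r \<le> hamming_weight v"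
  moreover have "card (supp ?w) \<le> card {j}" by (intro card_mono supp_smult_unit_vec) simp
  moreover have "card (supp v \<union> supp ?w) \<le> card (supp v) + card (supp ?w)" by (rule card_Un_le)
  ultimately have "card (supp v \<union> supp ?w) \<le> r" by (simp add: hamming_weight_supp)
  then have "v = ?w"
    using general_position_inj[OF H v(1), of ?w] eq j by (simp add: mult_smult_unit_vec[OF H(1)])
  then have "j \<in> supp v" using j a by (simp add: supp_def)
  then show False using j v by blast
qed

lemma coset_weight_remove_cols_le:
  fixes H :: "'a::{field,finite} mat"
  assumes H: "H \<in> carrier_mat r n" "general_position H" and D: "D \<subseteq> {..<n}"
    and n: "r + card D \<le> n" and s: "s \<in> carrier_vec r"
  shows "coset_weight (fiber (remove_cols H D) s) \<le> r"
proof -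
  have "card ({..<n} - D) = n - card D" using D by (simp add: card_Diff_subset finite_subset)
  then have "r \<le> card ({..<n} - D)" using n by simp
  then obtain J where J: "J \<subseteq> {..<n} - D" "card J = r"
    by (rule obtain_subset_with_card_n)
  then have "J \<subseteq> {..<n}" by blast
  then obtain v where v: "v \<in> carrier_vec n" "supp v \<subseteq> J" "H *\<^sub>v v = s"
    using general_position_span[OF H _ J(2) s] by blast
  have "finite J" using J(1) finite_subset by blast
  then have "hamming_weight v \<le> r" using card_mono[OF _ v(2)] J(2) by (simp add: hamming_weight_supp)
  moreover have "supp v \<inter> D = {}" using v(2) J(1) by blast
  ultimately show ?thesis
    using coset_weight_remove_cols_le_iff[OF H D n s] v by blast
qed

lemma coset_weight_removed_col:
  fixes H :: "'a::{field,finite} mat"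
  assumes H: "H \<in> carrier_mat r n" "general_position H" and D: "D \<subseteq> {..<n}"
    and n: "r + card D \<le> n" and j: "j \<in> D" and a: "a \<noteq> 0"
  shows "coset_weight (fiber (remove_cols H D) (a \<cdot>\<^sub>v col H j)) = r"
proof -
  have s: "a \<cdot>\<^sub>v col H j \<in> carrier_vec r" using H by auto
  let ?w = "coset_weight (fiber (remove_cols H D) (a \<cdot>\<^sub>v col H j))"
  obtain v where v: "v \<in> carrier_vec n" "supp v \<inter> D = {}" "hamming_weight v \<le> ?w"
      "H *\<^sub>v v = a \<cdot>\<^sub>v col H j"
    using coset_weight_remove_cols_le_iff[OF H D n s, of ?w] by blast
  then have "r \<le> ?w" using weight_of_removed_col[OF H _ j a v(1,2,4)] D j by auto
  then show ?thesis using coset_weight_remove_cols_le[OF H D n s] by simp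
qed

text \<open>A nonempty \<open>D\<close> supplies a removed column, whose coset attains the upper
  bound \<open>r\<close>.\<close>

lemma covering_radius_remove_cols:
  fixes H :: "'a::{field,finite} mat"
  assumes H: "H \<in> carrier_mat r n" "general_position H" and D: "D \<subseteq> {..<n}" "D \<noteq> {}"
    and n: "r + card D \<le> n"
  shows "covering_radius (n - card D) (mat_kernel (remove_cols H D)) = r"
proof -
  let ?H' = "remove_cols H D"
  have H': "?H' \<in> carrier_mat r (n - card D)" by (rule remove_cols_carrier[OF H(1) D(1)])
  obtain j where j: "j \<in> D" using D by blast
  have "1 \<cdot>\<^sub>v col H j \<in> (*\<^sub>v) ?H' ` carrier_vec (n - card D)"
    using general_position_surj[OF H' general_position_remove_cols[OF H D(1)]] n H by auto
  then obtain w where w: "w \<in> carrier_vec (n - card D)" "?H' *\<^sub>v w = 1 \<cdot>\<^sub>v col H j" by auto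
  show ?thesis
  proof (rule covering_radius_kernel[OF H' _ w(1)])
    show "coset_weight (fiber ?H' (?H' *\<^sub>v w)) = r"
      unfolding w(2) by (rule coset_weight_removed_col[OF H D(1) n j]) simp
    show "coset_weight (fiber ?H' (?H' *\<^sub>v v)) \<le> r" if "v \<in> carrier_vec (n - card D)" for v
      using H' that by (intro coset_weight_remove_cols_le[OF H D(1) n]) auto
  qed
qed

lemma num_cosets_remove_cols:
  fixes H :: "'a::{field,finite} mat"
  assumes H: "H \<in> carrier_mat r n" "general_position H" and D: "D \<subseteq> {..<n}"
    and n: "r + card D \<le> n"
  shows "num_cosets (n - card D) w (mat_kernel (remove_cols H D)) =
    card {s \<in> carrier_vec r. coset_weight (fiber (remove_cols H D) s) = w}"
  using num_cosets_kernel[OF remove_cols_carrier[OF H(1) D]] n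
    general_position_surj[OF remove_cols_carrier[OF H(1) D] general_position_remove_cols[OF H D]]
  by simp

lemma num_cosets_remove_cols_ge:
  fixes H :: "'a::{field,finite} mat"
  assumes H: "H \<in> carrier_mat r n" "general_position H" and r: "2 \<le> r" and D: "D \<subseteq> {..<n}"
    and n: "r + card D \<le> n"
  shows "(CARD('a) - 1) * card D \<le> num_cosets (n - card D) r (mat_kernel (remove_cols H D))"
  unfolding num_cosets_remove_cols[OF H D n] card_scaled_cols[OF H r D, symmetric]
  using H(1) coset_weight_removed_col[OF H D n]
  by (intro card_mono) (auto intro: finite_subset[OF _ finite_carrier_vec])

definition multiples_of_cols :: "'a::field mat \<Rightarrow> 'a vec set" where
  "multiples_of_cols H = {a \<cdot>\<^sub>v col H j | a j. j < dim_col H}"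

text \<open>Zero and the multiples of surviving columns have coset weight at most 1, which is below
  \<open>r\<close>. Once \<open>short\<close> disposes of the points off the arc, only nonzero
  multiples of removed columns are left.\<close>

lemma num_cosets_remove_cols_eq:
  fixes H :: "'a::{field,finite} mat"
  assumes H: "H \<in> carrier_mat r n" "general_position H" and r: "2 \<le> r" and D: "D \<subseteq> {..<n}"
    and n: "r + card D \<le> n"
    and short: "\<And>s. s \<in> carrier_vec r \<Longrightarrow> s \<notin> multiples_of_cols H \<Longrightarrow>
      \<exists>v \<in> carrier_vec n. supp v \<inter> D = {} \<and> hamming_weight v < r \<and> H *\<^sub>v v = s"
  shows "num_cosets (n - card D) r (mat_kernel (remove_cols H D)) = (CARD('a) - 1) * card D"
proof -
  have "s \<in> {a \<cdot>\<^sub>v col H j | a j. a \<noteq> 0 \<and> j \<in> D}"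
    if s: "s \<in> carrier_vec r" and eq: "coset_weight (fiber (remove_cols H D) s) = r" for s
  proof -
    have long: "\<not> (\<exists>v \<in> carrier_vec n. supp v \<inter> D = {} \<and> hamming_weight v < r \<and> H *\<^sub>v v = s)"
      using coset_weight_remove_cols_le_iff[OF H D n s, of "r - 1"] eq r by auto
    with short[OF s] obtain a j where j: "j < n" and s_eq: "s = a \<cdot>\<^sub>v col H j"
      using H(1) by (auto simp: multiples_of_cols_def)
    let ?v = "a \<cdot>\<^sub>v unit_vec n j"
    have "hamming_weight ?v \<le> card {j}"
      unfolding hamming_weight_supp by (intro card_mono supp_smult_unit_vec) simp
    then have "hamming_weight ?v < r" using r by simp
    then have meet: "supp ?v \<inter> D \<noteq> {}"
      using long j by (auto simp: s_eq mult_smult_unit_vec[OF H(1)])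
    then have "j \<in> D" using supp_smult_unit_vec[of a n j] by blast
    moreover have "a \<noteq> 0" using meet by (auto simp: supp_def)
    ultimately show ?thesis using s_eq by blast
  qed
  then have "{s \<in> carrier_vec r. coset_weight (fiber (remove_cols H D) s) = r}
      = {a \<cdot>\<^sub>v col H j | a j. a \<noteq> 0 \<and> j \<in> D}"
    using H(1) coset_weight_removed_col[OF H D n] by auto
  then show ?thesis
    by (simp only: num_cosets_remove_cols[OF H D n] card_scaled_cols[OF H r D])
qed

text \<open>The vector witnessing the lower bound is a sum of \<open>r - 1\<close> columns; comparing it with a
  shorter combination involves at most \<open>2 * r - 3\<close> columns, which is where \<open>r \<le> 3\<close> enters.\<close>

lemma covering_radius_short:
  fixes H :: "'a::{field,finite} mat"
  assumes H: "H \<in> carrier_mat r n" "general_position H" and r: "2 \<le> r" "r \<le> 3" "r \<le> n"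
    and short: "\<And>s. s \<in> carrier_vec r \<Longrightarrow> s \<notin> multiples_of_cols H \<Longrightarrow>
      \<exists>v \<in> carrier_vec n. hamming_weight v < r \<and> H *\<^sub>v v = s"
  shows "covering_radius n (mat_kernel H) = r - 1"
proof -
  have le: "coset_weight (fiber H (H *\<^sub>v v)) \<le> r - 1" if v: "v \<in> carrier_vec n" for v
  proof -
    have s: "H *\<^sub>v v \<in> carrier_vec r" using H(1) v by simp
    have "\<exists>u \<in> carrier_vec n. hamming_weight u \<le> r - 1 \<and> H *\<^sub>v u = H *\<^sub>v v"
    proof (cases "H *\<^sub>v v \<in> multiples_of_cols H")
      case True
      then obtain a j where j: "j < n" and eq: "H *\<^sub>v v = a \<cdot>\<^sub>v col H j"
        using H(1) by (auto simp: multiples_of_cols_def)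
      let ?u = "a \<cdot>\<^sub>v unit_vec n j"
      have "hamming_weight ?u \<le> card {j}"
        unfolding hamming_weight_supp by (intro card_mono supp_smult_unit_vec) simp
      then have "hamming_weight ?u \<le> r - 1" using r by simp
      then show ?thesis unfolding eq
        using j mult_smult_unit_vec[OF H(1) j, of a] by (intro bexI[of _ ?u]) auto
    next
      case False
      then obtain u where u: "u \<in> carrier_vec n" "hamming_weight u < r" "H *\<^sub>v u = H *\<^sub>v v"
        using short[OF s] by blast
      then have "hamming_weight u \<le> r - 1" by simp
      with u show ?thesis by blast
    qed
    then show ?thesis using coset_weight_fiber_le_iff[OF H(1), of "H *\<^sub>v v" "r - 1"] v by blast
  qed
  let ?w = "vec n (\<lambda>i. if i < r - 1 then 1 else 0) :: 'a vec"
  have w: "?w \<in> carrier_vec n" by simp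
  have supp_w: "supp ?w = {..<r - 1}" using r by (auto simp: supp_def split: if_splits)
  let ?c = "coset_weight (fiber H (H *\<^sub>v ?w))"
  obtain u where u: "u \<in> carrier_vec n" "hamming_weight u \<le> ?c" "H *\<^sub>v u = H *\<^sub>v ?w"
    using coset_weight_fiber_le_iff[OF H(1), of "H *\<^sub>v ?w" ?c] w by blast
  have "r - 1 \<le> ?c"
  proof (rule ccontr)
    assume "\<not> r - 1 \<le> ?c"
    then have small: "hamming_weight u < r - 1" using u by simp
    have "card (supp u \<union> supp ?w) \<le> card (supp u) + card (supp ?w)" by (rule card_Un_le)
    also have "\<dots> \<le> r" using small r unfolding supp_w hamming_weight_supp by simp
    finally have "u = ?w" using general_position_inj[OF H u(1) w u(3)] by simp
    then show False using small supp_w by (simp add: hamming_weight_supp)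
  qed
  with le[OF w] have "?c = r - 1" by simp
  with covering_radius_kernel[OF H(1) le w] show ?thesis by simp
qed

section \<open>Covering by few columns\<close>

text \<open>The \<open>q + 1\<close> columns are all the points of the projective line: their
  \<open>(q - 1) * (q + 1)\<close> nonzero multiples are distinct and as many as the nonzero
  vectors.\<close>

lemma all_multiples_of_cols:
  fixes H :: "'a::{field,finite} mat"
  assumes H: "H \<in> carrier_mat 2 (CARD('a) + 1)" "general_position H" and s: "s \<in> carrier_vec 2"
  shows "s \<in> multiples_of_cols H"
proof -
  let ?n = "CARD('a) + 1"
  let ?M = "{a \<cdot>\<^sub>v col H j | a j. a \<noteq> 0 \<and> j \<in> {..<?n}}"
  have M: "?M \<subseteq> carrier_vec 2 - {0\<^sub>v 2}"
  proof
    fix x assume "x \<in> ?M"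
    then obtain a j where x: "x = a \<cdot>\<^sub>v col H j" "a \<noteq> 0" "j < ?n" by blast
    have "x \<noteq> 0\<^sub>v 2"
    proof
      assume "x = 0\<^sub>v 2"
      then have "a \<cdot>\<^sub>v col H j = 0 \<cdot>\<^sub>v col H j" using x H(1) by (intro eq_vecI) auto
      then show False using scaled_col_inj[OF H order_refl x(3) x(3) x(2)] x(2) by blast
    qed
    then show "x \<in> carrier_vec 2 - {0\<^sub>v 2}" using x H(1) by auto
  qed
  have "card ?M = (CARD('a) - 1) * ?n" using card_scaled_cols[OF H order_refl, of "{..<?n}"] by simp
  also have "\<dots> = CARD('a) ^ 2 - 1" by (simp add: power2_eq_square diff_mult_distrib)
  also have "\<dots> = card (carrier_vec 2 - {0\<^sub>v 2} :: 'a vec set)"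
    by (simp add: card_carrier_vec card_Diff_subset)
  finally have "?M = carrier_vec 2 - {0\<^sub>v 2}" using M by (intro card_subset_eq) auto
  moreover have "0\<^sub>v 2 = 0 \<cdot>\<^sub>v col H 0" using H(1) by (intro eq_vecI) auto
  ultimately have "s \<in> {a \<cdot>\<^sub>v col H j | a j. j < ?n}"
    using s by (cases "s = 0\<^sub>v 2") (auto, blast)
  then show ?thesis using H(1) by (simp add: multiples_of_cols_def)
qed

section \<open>Secants and tangents of an arc in the projective plane\<close>

definition pair_vec :: "nat \<Rightarrow> nat \<Rightarrow> 'a::field \<Rightarrow> nat \<Rightarrow> 'a \<Rightarrow> 'a vec" where
  "pair_vec n i a j b = a \<cdot>\<^sub>v unit_vec n i + b \<cdot>\<^sub>v unit_vec n j"

lemma pair_vec_carrier [simp]: "pair_vec n i a j b \<in> carrier_vec n"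
  by (simp add: pair_vec_def)

lemma pair_vec_index:
  "k < n \<Longrightarrow> pair_vec n i a j b $ k = (if k = i then a else 0) + (if k = j then b else 0)"
  by (simp add: pair_vec_def unit_vec_def)

lemma supp_pair_vec: "supp (pair_vec n i a j b) \<subseteq> {i, j}"
  by (auto simp: supp_def pair_vec_def unit_vec_def split: if_splits)

lemma mult_pair_vec:
  fixes H :: "'a::{field,finite} mat"
  assumes H: "H \<in> carrier_mat r n" and "i < n" "j < n"
  shows "H *\<^sub>v pair_vec n i a j b = a \<cdot>\<^sub>v col H i + b \<cdot>\<^sub>v col H j"
  unfolding pair_vec_def using assms
  by (simp add: mult_add_distrib_mat_vec[OF H] mult_smult_unit_vec[OF H])

text \<open>Two chords sharing an endpoint involve at most three columns, and these are independent;
  so an equality of points on them is an equality of coefficients.\<close>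

lemma pair_vec_inj:
  fixes H :: "'a::{field,finite} mat"
  assumes H: "H \<in> carrier_mat 3 n" "general_position H"
    and n: "i < n" "j < n" "k < n" "l < n" and three: "card {i, j, k, l} \<le> 3"
    and eq: "a \<cdot>\<^sub>v col H i + b \<cdot>\<^sub>v col H j = c \<cdot>\<^sub>v col H k + d \<cdot>\<^sub>v col H l"
  shows "pair_vec n i a j b = pair_vec n k c l d"
proof (rule general_position_inj[OF H])
  have "supp (pair_vec n i a j b) \<union> supp (pair_vec n k c l d) \<subseteq> {i, j, k, l}"
    using supp_pair_vec[of n i a j b] supp_pair_vec[of n k c l d] by blast
  then have "card (supp (pair_vec n i a j b) \<union> supp (pair_vec n k c l d)) \<le> card {i, j, k, l}"
    by (intro card_mono) auto
  then show "card (supp (pair_vec n i a j b) \<union> supp (pair_vec n k c l d)) \<le> 3" using three by simp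
qed (use eq n in \<open>simp_all add: mult_pair_vec[OF H(1)]\<close>)

text \<open>For columns in general position and \<open>s\<close> off their multiples, these are the
  columns whose line to \<open>s\<close> meets the arc nowhere else: the points of contact of the
  tangents through \<open>s\<close>.\<close>

definition tangent_cols :: "'a::field mat \<Rightarrow> 'a vec \<Rightarrow> nat set" where
  "tangent_cols H s = {i. i < dim_col H \<and>
     (\<forall>j < dim_col H. j \<noteq> i \<longrightarrow> (\<forall>a b. s \<noteq> a \<cdot>\<^sub>v col H i + b \<cdot>\<^sub>v col H j))}"

text \<open>If \<open>s\<close> lies on no secant through two columns outside \<open>D\<close>, then sending a column outside
  \<open>D\<close> to the second column on its line through \<open>s\<close> injects the non-tangent ones into \<open>D\<close>.\<close>

lemma short_if_few_tangents:
  fixes H :: "'a::{field,finite} mat"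
  assumes H: "H \<in> carrier_mat 3 n" "general_position H" and D: "D \<subseteq> {..<n}"
    and s: "s \<notin> multiples_of_cols H"
    and few: "card (tangent_cols H s) + 2 * card D < n"
  shows "\<exists>v \<in> carrier_vec n. supp v \<inter> D = {} \<and> hamming_weight v < 3 \<and> H *\<^sub>v v = s"
proof (rule ccontr)
  assume no: "\<not> ?thesis"
  let ?T = "tangent_cols H s"
  let ?S = "{..<n} - D - ?T"
  have finD: "finite D" using D finite_subset by blast
  have "\<exists>j a b. j < n \<and> j \<noteq> i \<and> s = a \<cdot>\<^sub>v col H i + b \<cdot>\<^sub>v col H j" if "i \<in> ?S" for i
    using that H(1) by (auto simp: tangent_cols_def)
  then obtain \<sigma> a b where \<sigma>: "\<And>i. i \<in> ?S \<Longrightarrow> \<sigma> i < n" "\<And>i. i \<in> ?S \<Longrightarrow> \<sigma> i \<noteq> i"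
    and eq: "\<And>i. i \<in> ?S \<Longrightarrow> s = a i \<cdot>\<^sub>v col H i + b i \<cdot>\<^sub>v col H (\<sigma> i)"
    by metis
  \<comment> \<open>Otherwise \<open>s\<close> would come from a word on two surviving columns, of
    weight at most 2.\<close>
  have in_D: "\<sigma> i \<in> D" if i: "i \<in> ?S" for i
  proof (rule ccontr)
    assume "\<sigma> i \<notin> D"
    let ?v = "pair_vec n i (a i) (\<sigma> i) (b i)"
    have "hamming_weight ?v \<le> card {i, \<sigma> i}"
      unfolding hamming_weight_supp by (intro card_mono supp_pair_vec) simp
    also have "\<dots> < 3" by (simp add: card_insert_if)
    finally have "hamming_weight ?v < 3" .
    moreover have "supp ?v \<inter> D = {}"
      using supp_pair_vec[of n i "a i" "\<sigma> i" "b i"] i \<open>\<sigma> i \<notin> D\<close> by blast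
    moreover have "H *\<^sub>v ?v = s" using mult_pair_vec[OF H(1)] eq[OF i] \<sigma>(1)[OF i] i by simp
    ultimately show False using no pair_vec_carrier by blast
  qed
  have "inj_on \<sigma> ?S"
  proof (rule inj_onI, rule ccontr)
    fix i k assume i: "i \<in> ?S" and k: "k \<in> ?S" and same: "\<sigma> i = \<sigma> k" and "i \<noteq> k"
    have "pair_vec n i (a i) (\<sigma> i) (b i) = pair_vec n k (a k) (\<sigma> k) (b k)"
    proof (rule pair_vec_inj[OF H])
      show "card {i, \<sigma> i, k, \<sigma> k} \<le> 3" by (simp add: same card_insert_if)
      show "a i \<cdot>\<^sub>v col H i + b i \<cdot>\<^sub>v col H (\<sigma> i) = a k \<cdot>\<^sub>v col H k + b k \<cdot>\<^sub>v col H (\<sigma> k)"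
        using eq[OF i] eq[OF k] by simp
    qed (use i k \<sigma> in auto)
    \<comment> \<open>Coordinate \<open>i\<close> of the right side is 0, since \<open>i\<close>
      differs from \<open>k\<close> and from the shared partner; so \<open>s\<close> would be a
      multiple of one column.\<close>
    then have "pair_vec n i (a i) (\<sigma> i) (b i) $ i = pair_vec n k (a k) (\<sigma> k) (b k) $ i" by simp
    then have "a i = 0" using i \<open>i \<noteq> k\<close> \<sigma>(2)[OF i] same by (simp add: pair_vec_index split: if_splits)
    then have "s = b i \<cdot>\<^sub>v col H (\<sigma> i)" using eq[OF i] H(1) by (intro eq_vecI) auto
    then show False using s \<sigma>(1)[OF i] H(1) by (auto simp: multiples_of_cols_def)
  qed
  then have "card ?S \<le> card D" using in_D finD by (intro card_inj_on_le[of \<sigma>]) auto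
  \<comment> \<open>Every column is removed, tangent or in the domain of the injection, whence
    \<open>n <= 2 * card D + card ?T\<close>.\<close>
  moreover have "card {..<n} \<le> card ?S + card D + card ?T"
  proof -
    have "?T \<subseteq> {..<n}" using H(1) by (auto simp: tangent_cols_def)
    then have finT: "finite ?T" using finite_subset by blast
    have "card {..<n} \<le> card (?S \<union> D \<union> ?T)" using finD finT by (intro card_mono) auto
    also have "\<dots> \<le> card ?S + card D + card ?T"
      by (meson add_mono card_Un_le le_refl order_trans)
    finally show ?thesis .
  qed
  ultimately show False using few by simp
qed

text \<open>Only \<open>q + 1\<close> lines pass through a point, and the other \<open>q + 1\<close>
  columns lie on different ones, so each line through a column is a secant. In vectors: the joins of
  column \<open>i\<close> to the others, together with the multiples of column \<open>i\<close>,
  contain \<open>(q + 1) * q * (q - 1) + q = q ^ 3\<close> vectors.\<close>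

lemma hyperoval_no_tangents:
  fixes H :: "'a::{field,finite} mat"
  assumes H: "H \<in> carrier_mat 3 (CARD('a) + 2)" "general_position H"
    and s: "s \<in> carrier_vec 3" "s \<notin> multiples_of_cols H"
  shows "tangent_cols H s = {}"
proof (rule ccontr)
  let ?n = "CARD('a) + 2"
  let ?q = "CARD('a)"
  assume "tangent_cols H s \<noteq> {}"
  then obtain i where i: "i < ?n"
    and tangent: "\<And>j a b. j < ?n \<Longrightarrow> j \<noteq> i \<Longrightarrow> s \<noteq> a \<cdot>\<^sub>v col H i + b \<cdot>\<^sub>v col H j"
    using H(1) by (auto simp: tangent_cols_def)
  \<comment> \<open>A nonzero \<open>b\<close> leaves out column \<open>i\<close>, the common point
    of the joins, so that no vector is counted twice.\<close>
  let ?A = "({..<?n} - {i}) \<times> (UNIV :: 'a set) \<times> (UNIV - {0 :: 'a})"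
  let ?f = "\<lambda>(j, a, b). a \<cdot>\<^sub>v col H i + b \<cdot>\<^sub>v col H j"
  let ?R = "range (\<lambda>a. a \<cdot>\<^sub>v col H i)"
  \<comment> \<open>Only the columns \<open>i\<close>, \<open>j\<close>, \<open>j'\<close> occur. If
    both outer coefficients vanish, nothing ties \<open>j\<close> to \<open>j'\<close>, hence the
    first alternative.\<close>
  have eqD: "b = 0 \<and> b' = 0 \<and> a = a' \<or> j = j' \<and> a = a' \<and> b = b'"
    if j: "j < ?n" "j \<noteq> i" "j' < ?n" "j' \<noteq> i"
      and eq: "a \<cdot>\<^sub>v col H i + b \<cdot>\<^sub>v col H j = a' \<cdot>\<^sub>v col H i + b' \<cdot>\<^sub>v col H j'" for j j' a a' b b'
  proof -
    have "card {i, j, i, j'} \<le> 3" by (simp add: card_insert_if)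
    then have *: "pair_vec ?n i a j b = pair_vec ?n i a' j' b'"
      by (intro pair_vec_inj[OF H _ _ _ _ _ eq]) (use i j in auto)
    have "pair_vec ?n i a j b $ k = pair_vec ?n i a' j' b' $ k" for k using * by simp
    from this[of i] this[of j] this[of j'] show ?thesis
      using i j by (auto simp: pair_vec_index split: if_splits)
  qed
  have "inj_on ?f ?A"
  proof (rule inj_onI)
    fix x y assume xy: "x \<in> ?A" "y \<in> ?A" "?f x = ?f y"
    obtain j a b j' a' b' where "x = (j, a, b)" "y = (j', a', b')" by (cases x, cases y)
    then show "x = y" using xy eqD[of j j' a b a' b'] by auto
  qed
  then have "card (?f ` ?A) = card ?A" by (rule card_image)
  also have "\<dots> = (?q + 1) * (?q * (?q - 1))" using i by (simp add: card_cartesian_product card_Diff_subset)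
  also have "\<dots> = ?q ^ 3 - ?q"
    by (simp add: power3_eq_cube algebra_simps diff_mult_distrib2)
  finally have cardA: "card (?f ` ?A) = ?q ^ 3 - ?q" .
  have "inj (\<lambda>a. a \<cdot>\<^sub>v col H i)"
  proof (rule injI)
    fix a b assume "a \<cdot>\<^sub>v col H i = b \<cdot>\<^sub>v col H i"
    then show "a = b" using scaled_col_inj[OF H _ i i, of a b] scaled_col_inj[OF H _ i i, of b a] by fastforce
  qed
  then have cardR: "card ?R = ?q" by (rule card_image)
  have disj: "?f ` ?A \<inter> ?R = {}"
  proof (rule ccontr)
    assume "?f ` ?A \<inter> ?R \<noteq> {}"
    then obtain j a b c where j: "j < ?n" "j \<noteq> i" "b \<noteq> 0"
      and eq: "a \<cdot>\<^sub>v col H i + b \<cdot>\<^sub>v col H j = c \<cdot>\<^sub>v col H i" by auto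
    have "c \<cdot>\<^sub>v col H i = c \<cdot>\<^sub>v col H i + 0 \<cdot>\<^sub>v col H j" using H(1) by (intro eq_vecI) auto
    with eq have "a \<cdot>\<^sub>v col H i + b \<cdot>\<^sub>v col H j = c \<cdot>\<^sub>v col H i + 0 \<cdot>\<^sub>v col H j" by simp
    from eqD[OF j(1,2) j(1,2) this] j(3) show False by auto
  qed
  have "card (?f ` ?A \<union> ?R) = card (?f ` ?A) + card ?R"
    by (rule card_Un_disjoint[OF _ _ disj]) simp_all
  also have "\<dots> = ?q ^ 3 - ?q + ?q" by (simp only: cardA cardR)
  also have "\<dots> = card (carrier_vec 3 :: 'a vec set)"
    by (simp add: card_carrier_vec self_le_power)
  finally have "card (?f ` ?A \<union> ?R) = card (carrier_vec 3 :: 'a vec set)" .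
  moreover have "?f ` ?A \<union> ?R \<subseteq> carrier_vec 3"
  proof -
    have "col H j \<in> carrier_vec 3" for j using col_dim[of H j] H(1) by simp
    then show ?thesis by auto
  qed
  ultimately have "?f ` ?A \<union> ?R = carrier_vec 3" by (intro card_subset_eq) auto
  then have "s \<in> ?f ` ?A \<union> ?R" using s(1) by simp
  then show False
  proof
    assume "s \<in> ?f ` ?A"
    then show False using tangent by auto
  next
    assume "s \<in> ?R"
    then show False using s(2) i H(1) by (auto simp: multiples_of_cols_def)
  qed
qed

section \<open>Normal rational curves and hyperovals\<close>

text \<open>Translation by 1 permutes the field, so the sum of all elements is unchanged although
  \<open>q\<close> times 1 has been added.\<close>

lemma of_nat_card_eq_0: "of_nat CARD('a) = (0 :: 'a::{field,finite})"
proof -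
  have "(\<Sum>x::'a\<in>UNIV. x + 1) = (\<Sum>x\<in>UNIV. x)"
    by (rule sum.reindex_bij_witness[of _ "\<lambda>x. x - 1" "\<lambda>x. x + 1"]) auto
  then show ?thesis by (simp add: sum.distrib)
qed

lemma two_neq_0_if_odd_card:
  assumes "odd CARD('a::{field,finite})"
  shows "(2 :: 'a) \<noteq> 0"
proof
  assume "(2 :: 'a) = 0"
  obtain k where "CARD('a) = 2 * k + 1" using assms by (auto elim: oddE)
  then have "of_nat CARD('a) = (2 :: 'a) * of_nat k + 1" by simp
  then show False using \<open>(2 :: 'a) = 0\<close> of_nat_card_eq_0[where 'a = 'a] by simp
qed

text \<open>Negation permutes the nonzero elements and so fixes their product, yet multiplies it by
  \<open>- 1\<close> because their number \<open>q - 1\<close> is odd. The product is nonzero, hence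
  \<open>- 1 = 1\<close>.\<close>

lemma two_eq_0_if_even_card:
  assumes "even CARD('a::{field,finite})"
  shows "(2 :: 'a) = 0"
proof -
  let ?U = "UNIV - {0 :: 'a}"
  have "odd (card ?U)" using assms by (simp add: card_Diff_subset)
  moreover have "(\<Prod>x\<in>?U. - x) = (\<Prod>x\<in>?U. x)"
    by (rule prod.reindex_bij_witness[of _ uminus uminus]) auto
  then have "(- 1) ^ card ?U * (\<Prod>x\<in>?U. x) = (\<Prod>x\<in>?U. x)"
    by (simp add: prod_uminus)
  ultimately have "(- 1 :: 'a) = 1" by simp
  then show ?thesis by (metis add_eq_0_iff one_add_one)
qed

text \<open>A linear form vanishing on all columns of \<open>J\<close> except column
  \<open>i\<close> isolates the entry of a kernel word at \<open>i\<close> and forces it to be 0;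
  such forms take the place of determinants.\<close>

lemma general_positionI:
  fixes H :: "'a::{field,finite} mat"
  assumes H: "H \<in> carrier_mat r n" and "r \<le> n"
    and sep: "\<And>J i. J \<subseteq> {..<n} \<Longrightarrow> card J = r \<Longrightarrow> i \<in> J \<Longrightarrow>
      \<exists>l \<in> carrier_vec r. l \<bullet> col H i \<noteq> 0 \<and> (\<forall>k \<in> J - {i}. l \<bullet> col H k = 0)"
  shows "general_position H"
  unfolding general_position_def
proof (intro ballI impI, rule ccontr)
  fix v assume "v \<in> mat_kernel H" and wt: "hamming_weight v \<le> dim_row H" and nz: "v \<noteq> 0\<^sub>v (dim_col H)"
  then have v: "v \<in> carrier_vec n" "H *\<^sub>v v = 0\<^sub>v r" using mat_kernelD[OF H] by auto
  then obtain i where i: "i \<in> supp v" using nz H supp_empty_iff[of v n] by auto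
  have "card (supp v) \<le> r" "r \<le> card {..<n}" using wt H \<open>r \<le> n\<close> by (auto simp: hamming_weight_supp)
  \<comment> \<open>The separating forms are given for sets of exactly \<open>r\<close> columns, so
    the support is padded.\<close>
  then obtain J where J: "supp v \<subseteq> J" "J \<subseteq> {..<n}" "card J = r"
    using exists_subset_between[OF _ _ supp_subset[OF v(1)]] by blast
  obtain l where l: "l \<in> carrier_vec r" "l \<bullet> col H i \<noteq> 0" "\<And>k. k \<in> J - {i} \<Longrightarrow> l \<bullet> col H k = 0"
    using sep[OF J(2,3)] i J(1) by blast
  have "l \<bullet> (H *\<^sub>v v) = (\<Sum>m<r. \<Sum>k<n. l $ m * (H $$ (m, k) * v $ k))"
    using H v(1) by (simp add: scalar_prod_def atLeast0LessThan sum_distrib_left)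
  also have "\<dots> = (\<Sum>k<n. v $ k * (l \<bullet> col H k))"
    unfolding sum.swap[of _ "{..<n}"] using H
    by (intro sum.cong) (auto simp: scalar_prod_def atLeast0LessThan sum_distrib_left mult_ac)
  also have "\<dots> = (\<Sum>k\<in>{i}. v $ k * (l \<bullet> col H k))"
  proof (rule sum.mono_neutral_right)
    show "\<forall>k\<in>{..<n} - {i}. v $ k * (l \<bullet> col H k) = 0"
    proof
      fix k assume k: "k \<in> {..<n} - {i}"
      show "v $ k * (l \<bullet> col H k) = 0"
        using k l(3)[of k] J(1) not_in_supp[OF v(1), of k] by (cases "k \<in> supp v") auto
    qed
  qed (use i supp_subset[OF v(1)] in auto)
  also have "\<dots> \<noteq> 0" using i l(2) by (simp add: supp_def)
  finally show False using v(2) l(1) by simp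
qed

text \<open>Nonzero scaling does not change where a linear form vanishes, so separation is checked
  on the unscaled points.\<close>

lemma general_position_scaled_columns:
  fixes H :: "'a::{field,finite} mat"
  assumes H: "H \<in> carrier_mat r n" and "r \<le> n" and S: "S \<subseteq> carrier_vec r" "scaled_columns H S"
    and sep: "\<And>P x. P \<subseteq> S \<Longrightarrow> card P = r \<Longrightarrow> x \<in> P \<Longrightarrow>
      \<exists>l \<in> carrier_vec r. l \<bullet> x \<noteq> 0 \<and> (\<forall>y \<in> P - {x}. l \<bullet> y = 0)"
  shows "general_position H"
proof (rule general_positionI[OF H \<open>r \<le> n\<close>])
  fix J i assume J: "J \<subseteq> {..<n}" "card J = r" "i \<in> J"
  obtain p where p: "bij_betw p {..<n} S"
    and col: "\<And>j. j < n \<Longrightarrow> \<exists>a. a \<noteq> 0 \<and> col H j = a \<cdot>\<^sub>v p j"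
    using S(2) H by (auto simp: scaled_columns_def)
  have inj: "inj_on p {..<n}" using p by (rule bij_betw_imp_inj_on)
  have "p ` J \<subseteq> S" using bij_betw_imp_surj_on[OF p] J(1) by blast
  moreover have "card (p ` J) = r" using card_image[OF inj_on_subset[OF inj J(1)]] J(2) by simp
  ultimately obtain l where l: "l \<in> carrier_vec r" "l \<bullet> p i \<noteq> 0"
      "\<And>y. y \<in> p ` J - {p i} \<Longrightarrow> l \<bullet> y = 0"
    using sep[of "p ` J" "p i"] J(3) by blast
  have pc: "p j \<in> carrier_vec r" if "j < n" for j
    using bij_betwE[OF p] that S(1) by blast
  have "l \<bullet> col H i \<noteq> 0"
    using col[of i] pc[of i] l J by force
  moreover have "l \<bullet> col H k = 0" if k: "k \<in> J - {i}" for k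
  proof -
    have "p k \<noteq> p i" using inj_onD[OF inj, of k i] k J by auto
    then have "l \<bullet> p k = 0" using l(3) k by blast
    then show ?thesis using col[of k] pc[of k] l(1) k J by force
  qed
  ultimately show "\<exists>l \<in> carrier_vec r. l \<bullet> col H i \<noteq> 0 \<and> (\<forall>k \<in> J - {i}. l \<bullet> col H k = 0)"
    using l(1) by blast
qed

lemma scalar_prod_2: "vec 2 f \<bullet> x = f 0 * x $ 0 + f 1 * x $ 1" if "x \<in> carrier_vec 2"
  using that by (simp add: scalar_prod_def numeral_2_eq_2)

lemma scalar_prod_3: "vec 3 f \<bullet> x = f 0 * x $ 0 + f 1 * x $ 1 + f 2 * x $ 2" if "x \<in> carrier_vec 3"
  using that by (simp add: scalar_prod_def numeral_3_eq_3 numeral_2_eq_2)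

lemma gdrs_points_carrier: "gdrs_points d \<subseteq> carrier_vec (d - 1)"
  by (auto simp: gdrs_points_def)

lemma general_position_H3:
  fixes H :: "'a::{field,finite} mat"
  assumes "is_H 3 H"
  shows "general_position H"
proof (rule general_position_scaled_columns[where r = 2 and n = "CARD('a) + 1" and S = "gdrs_points 3"])
  show "2 \<le> CARD('a) + 1" by simp
  show "gdrs_points 3 \<subseteq> (carrier_vec 2 :: 'a vec set)" using gdrs_points_carrier[of 3, where 'a = 'a] by simp
  fix P :: "'a vec set" and x
  assume P: "P \<subseteq> gdrs_points 3" "card P = 2" "x \<in> P"
  then obtain y where y: "P = {x, y}" "x \<noteq> y" by (metis card_2_iff doubleton_eq_iff insertE singletonD)
  have c: "x \<in> carrier_vec 2" "y \<in> carrier_vec 2"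
    using P y gdrs_points_carrier[of 3, where 'a = 'a] by auto
  \<comment> \<open>The scalar product of \<open>l\<close> with \<open>x\<close> is the determinant
    \<open>y0 * x1 - y1 * x0\<close>.\<close>
  define l where "l = vec 2 (\<lambda>i. if i = 0 then - (y $ 1) else y $ 0)"
  have "l \<bullet> y = 0" by (simp add: l_def scalar_prod_2[OF c(2)])
  moreover have "l \<bullet> x \<noteq> 0"
    using P y by (auto simp: l_def scalar_prod_2[OF c(1)] gdrs_points_def)
  ultimately show "\<exists>l\<in>carrier_vec 2. l \<bullet> x \<noteq> 0 \<and> (\<forall>y\<in>P - {x}. l \<bullet> y = 0)"
    using y by (intro bexI[of _ l]) (auto simp: l_def)
qed (use assms in \<open>auto simp: is_H_def\<close>)

text \<open>The linear forms are the equations of the lines through two of the points: the chord of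
  \<open>(1, t, t\<^sup>2)\<close> and \<open>(1, s, s\<^sup>2)\<close> is \<open>s t x\<^sub>0 - (s + t) x\<^sub>1 + x\<^sub>2 = 0\<close>, and at \<open>(1, u, u\<^sup>2)\<close>
  the left-hand side is \<open>(u - s) (u - t)\<close>.\<close>

lemma conic_separation:
  fixes x y z :: "'a::{field,finite} vec"
  assumes S: "S = gdrs_points 4 \<or> even CARD('a) \<and> S = insert (unit_vec 3 1) (gdrs_points 4)"
    and xyz: "x \<in> S" "y \<in> S" "z \<in> S" "x \<noteq> y" "x \<noteq> z" "y \<noteq> z"
  shows "\<exists>l \<in> carrier_vec 3. l \<bullet> x \<noteq> 0 \<and> l \<bullet> y = 0 \<and> l \<bullet> z = 0"
proof -
  define pt :: "'a \<Rightarrow> 'a vec" where "pt t = vec 3 (\<lambda>i. t ^ i)" for t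
  define inf :: "'a vec" where "inf = unit_vec 3 2"
  define nuc :: "'a vec" where "nuc = unit_vec 3 1"
  define form :: "'a \<Rightarrow> 'a \<Rightarrow> 'a \<Rightarrow> 'a vec" where
    "form a b c = vec 3 (\<lambda>i. if i = 0 then a else if i = 1 then b else c)" for a b c
  have form_carrier: "form a b c \<in> carrier_vec 3" for a b c by (simp add: form_def)
  have val: "form a b c \<bullet> pt t = a + b * t + c * t\<^sup>2" "form a b c \<bullet> inf = c" "form a b c \<bullet> nuc = b"
    for a b c t
    by (simp_all add: form_def pt_def inf_def nuc_def scalar_prod_3)
  have pts: "w = inf \<or> (\<exists>t. w = pt t) \<or> w = nuc \<and> (2 :: 'a) = 0" if "w \<in> S" for w
    using that S two_eq_0_if_even_card[where 'a = 'a]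
    by (auto simp: gdrs_points_def pt_def inf_def nuc_def)
  have chord: "s * t + - (s + t) * u + 1 * u\<^sup>2 = (u - s) * (u - t)" for s t u :: 'a
    by (simp add: algebra_simps power2_eq_square)
  \<comment> \<open>Squaring is injective in characteristic 2; hence the line
    \<open>x2 = t^2 * x0\<close> through \<open>pt t\<close> and the nucleus \<open>nuc\<close>
    meets the conic only at \<open>pt t\<close>.\<close>
  have sq: "u\<^sup>2 = t\<^sup>2 \<longleftrightarrow> u = t" if "(2 :: 'a) = 0" for u t :: 'a
  proof -
    have "(u - t)\<^sup>2 = u\<^sup>2 - t\<^sup>2 - 2 * (u * t - t\<^sup>2)" by (simp add: algebra_simps power2_eq_square)
    then have "(u - t)\<^sup>2 = u\<^sup>2 - t\<^sup>2" using that by simp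
    then show ?thesis by (metis eq_iff_diff_eq_0 power_eq_0_iff zero_neq_numeral power_zero_numeral)
  qed
  \<comment> \<open>The chord form takes the value \<open>- (s + t)\<close> at \<open>nuc\<close>,
    which has to be nonzero.\<close>
  have neg: "s + t \<noteq> 0" if "(2 :: 'a) = 0" "s \<noteq> t" for s t :: 'a
  proof -
    have "t + t = 0" using that(1) by (metis mult_2 mult_zero_left)
    then have "- t = t" by (simp add: neg_eq_iff_add_eq_0)
    then show ?thesis using that(2) by (metis eq_neg_iff_add_eq_0)
  qed
  have ex: "\<exists>l \<in> carrier_vec 3. l \<bullet> x \<noteq> 0 \<and> l \<bullet> v = 0 \<and> l \<bullet> w = 0"
    if "form a b c \<bullet> x \<noteq> 0" "form a b c \<bullet> v = 0" "form a b c \<bullet> w = 0" for a b c v w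
    using that form_carrier by blast
  note x = pts[OF xyz(1)]
  \<comment> \<open>Fixes an order on the pair \<open>v\<close>, \<open>w\<close>, so that four
    kinds of lines suffice.\<close>
  define normal where "normal v w \<longleftrightarrow> (\<exists>t s. v = pt t \<and> w = pt s) \<or> (\<exists>t. v = pt t \<and> w = inf) \<or>
    (\<exists>t. v = pt t \<and> w = nuc \<and> (2 :: 'a) = 0) \<or> v = inf \<and> w = nuc" for v w
  have line: "\<exists>l \<in> carrier_vec 3. l \<bullet> x \<noteq> 0 \<and> l \<bullet> v = 0 \<and> l \<bullet> w = 0"
    if vw: "x \<noteq> v" "x \<noteq> w" "v \<noteq> w"
      and cases: "normal v w" for v w
    using cases unfolding normal_def
  proof (elim disjE exE conjE)
    fix t s assume v: "v = pt t" and w: "w = pt s"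
    have "s \<noteq> t" using v w vw by auto
    have "form (s * t) (- (s + t)) 1 \<bullet> x \<noteq> 0"
      using x
    proof (elim disjE exE conjE)
      fix u assume u: "x = pt u"
      then have "u \<noteq> s" "u \<noteq> t" using v w vw by auto
      moreover have "form (s * t) (- (s + t)) 1 \<bullet> x = (u - s) * (u - t)" unfolding u val chord ..
      ultimately show ?thesis by simp
    next
      assume "x = nuc" "(2 :: 'a) = 0"
      then show ?thesis using neg[OF _ \<open>s \<noteq> t\<close>] by (simp only: val neg_equal_0_iff_equal) simp
    qed (simp add: val)
    moreover have "form (s * t) (- (s + t)) 1 \<bullet> v = 0" "form (s * t) (- (s + t)) 1 \<bullet> w = 0"
      unfolding v w val chord by simp_all
    ultimately show ?thesis by (rule ex)
  next
    fix t assume v: "v = pt t" and w: "w = inf"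
    \<comment> \<open>The line \<open>x1 = t * x0\<close> through \<open>pt t\<close> and
      \<open>inf\<close>.\<close>
    show ?thesis
      by (rule ex[of "- t" 1 0]) (use x v w vw in \<open>auto simp: val\<close>)
  next
    fix t assume v: "v = pt t" and w: "w = nuc" and char2: "(2 :: 'a) = 0"
    show ?thesis
      by (rule ex[of "- t\<^sup>2" 0 1]) (use x v w vw sq[OF char2] in \<open>auto simp: val\<close>)
  next
    assume v: "v = inf" and w: "w = nuc"
    show ?thesis
      by (rule ex[of 1 0 0]) (use x v w vw in \<open>auto simp: val\<close>)
  qed
  show ?thesis
  proof -
    have "normal y z \<or> normal z y"
      using pts[OF xyz(2)] pts[OF xyz(3)] xyz(6) unfolding normal_def by blast
    then show ?thesis
    proof
      assume "normal y z"
      then show ?thesis using xyz by (intro line) auto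
    next
      assume "normal z y"
      then have "\<exists>l \<in> carrier_vec 3. l \<bullet> x \<noteq> 0 \<and> l \<bullet> z = 0 \<and> l \<bullet> y = 0"
        using xyz by (intro line) auto
      then show ?thesis by blast
    qed
  qed
qed

lemma general_position_conic:
  fixes H :: "'a::{field,finite} mat"
  assumes H: "H \<in> carrier_mat 3 n" "3 \<le> n" "scaled_columns H S"
    and S: "S = gdrs_points 4 \<or> even CARD('a) \<and> S = insert (unit_vec 3 1) (gdrs_points 4)"
  shows "general_position H"
proof (rule general_position_scaled_columns[OF H(1,2) _ H(3)])
  show "S \<subseteq> carrier_vec 3" using S gdrs_points_carrier[of 4, where 'a = 'a] by auto
  fix P :: "'a vec set" and x
  assume P: "P \<subseteq> S" "card P = 3" "x \<in> P"
  then have "card (P - {x}) = 2" by simp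
  then obtain y z where yz: "P - {x} = {y, z}" "y \<noteq> z" by (auto simp: card_2_iff)
  then have "x \<in> S" "y \<in> S" "z \<in> S" "x \<noteq> y" "x \<noteq> z" using P by auto
  then show "\<exists>l\<in>carrier_vec 3. l \<bullet> x \<noteq> 0 \<and> (\<forall>y\<in>P - {x}. l \<bullet> y = 0)"
    using conic_separation[OF S, of x y z] yz by auto
qed

section \<open>Tangents to the conic through a point off it\<close>

lemma card_quadratic_roots_le:
  fixes x y z :: "'a::idom"
  assumes "x \<noteq> 0"
  shows "finite {t. x * t\<^sup>2 + y * t + z = 0} \<and> card {t. x * t\<^sup>2 + y * t + z = 0} \<le> 2"
proof -
  let ?p = "[:z, y, x:]"
  have "?p \<noteq> 0" using assms by simp
  moreover have "{t. poly ?p t = 0} = {t. x * t\<^sup>2 + y * t + z = 0}"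
    by (auto simp: power2_eq_square algebra_simps)
  ultimately have "finite {t. x * t\<^sup>2 + y * t + z = 0}" "card {t. x * t\<^sup>2 + y * t + z = 0} \<le> degree ?p"
    using poly_roots_finite[of ?p] card_poly_roots_bound[of ?p] by simp_all
  then show ?thesis using assms by simp
qed

text \<open>For \<open>s = (x, y, z)\<close> off the conic, \<open>(1, t, t\<^sup>2)\<close> lies on the polar line
  \<open>x t\<^sup>2 - 2 y t + z = 0\<close> of \<open>s\<close> if it is on no secant through \<open>s\<close>.\<close>

lemma conic_tangents:
  fixes s :: "'a::{field,finite} vec"
  assumes two: "(2 :: 'a) \<noteq> 0" and s: "s \<in> carrier_vec 3"
    and off: "\<And>w a. w \<in> gdrs_points 4 \<Longrightarrow> s \<noteq> a \<cdot>\<^sub>v w"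
  shows "card {v \<in> gdrs_points 4. \<forall>w \<in> gdrs_points 4. w \<noteq> v \<longrightarrow> (\<forall>a b. s \<noteq> a \<cdot>\<^sub>v v + b \<cdot>\<^sub>v w)} \<le> 2"
    (is "card ?T \<le> 2")
proof -
  define pt :: "'a \<Rightarrow> 'a vec" where "pt t = vec 3 (\<lambda>i. t ^ i)" for t
  define inf :: "'a vec" where "inf = unit_vec 3 2"
  have points: "gdrs_points 4 = insert inf (range pt)"
    by (simp add: gdrs_points_def pt_def inf_def)
  define x y z where "x = s $ 0" and "y = s $ 1" and "z = s $ 2"
  have vec_eq_3: "v = w \<longleftrightarrow> v $ 0 = w $ 0 \<and> v $ 1 = w $ 1 \<and> v $ 2 = w $ 2"
    if "v \<in> carrier_vec 3" "w \<in> carrier_vec 3" for v w :: "'a vec"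
    using that by (auto intro!: eq_vecI simp: less_Suc_eq numeral_3_eq_3 numeral_2_eq_2)
  have carrier: "pt t \<in> carrier_vec 3" "inf \<in> carrier_vec 3" for t by (simp_all add: pt_def inf_def)
  have pt_inf: "pt t \<noteq> inf" for t
    using vec_eq_3[OF carrier, of t] by (simp add: pt_def inf_def)
  have pt_inj: "pt t \<noteq> pt u" if "t \<noteq> u" for t u
    using vec_eq_3[OF carrier(1,1), of t u] that by (simp add: pt_def)
  have comb_inf: "s = a \<cdot>\<^sub>v pt t + b \<cdot>\<^sub>v inf \<longleftrightarrow> x = a \<and> y = a * t \<and> z = a * t\<^sup>2 + b" for a b t
    using s carrier by (subst vec_eq_3) (auto simp: pt_def inf_def x_def y_def z_def)
  have comb_pt: "s = a \<cdot>\<^sub>v pt t + b \<cdot>\<^sub>v pt u \<longleftrightarrow>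
      x = a + b \<and> y = a * t + b * u \<and> z = a * t\<^sup>2 + b * u\<^sup>2" for a b t u
    using s carrier by (subst vec_eq_3) (auto simp: pt_def x_def y_def z_def)
  have comm: "a \<cdot>\<^sub>v inf + b \<cdot>\<^sub>v pt t = b \<cdot>\<^sub>v pt t + a \<cdot>\<^sub>v inf" for a b t
    using carrier by (intro comm_add_vec) auto
  have tangent_pt: "x * t\<^sup>2 + (- 2 * y) * t + z = 0" if t: "pt t \<in> ?T" for t
  proof (rule ccontr)
    assume nz: "x * t\<^sup>2 + (- 2 * y) * t + z \<noteq> 0"
    \<comment> \<open>If \<open>x * t = y\<close>, then \<open>s\<close> lies on the secant joining
      \<open>pt t\<close> to \<open>inf\<close>.\<close>
    have "x * t \<noteq> y"
      using t comb_inf[of x t "z - x * t\<^sup>2"] pt_inf[of t] by (auto simp: points)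
    \<comment> \<open>The second point of the conic on the line from \<open>pt t\<close> through
      \<open>s\<close>: the chord equation \<open>t * u * x - (t + u) * y + z = 0\<close> is linear
      in \<open>u\<close>.\<close>
    define u where "u = (y * t - z) / (x * t - y)"
    have u: "u * (x * t - y) = y * t - z" using \<open>x * t \<noteq> y\<close> by (simp add: u_def)
    \<comment> \<open>Equality would put \<open>pt t\<close> on the polar line, against
      \<open>nz\<close>.\<close>
    have "u \<noteq> t"
    proof
      assume "u = t"
      with u show False using nz by (simp add: algebra_simps power2_eq_square)
    qed
    \<comment> \<open>Solves the first two coordinate equations with \<open>x - b\<close> as the
      other coefficient; the third then holds by the choice of \<open>u\<close>.\<close>
    define b where "b = (y - x * t) / (u - t)"
    have b: "b * (u - t) = y - x * t" using \<open>u \<noteq> t\<close> by (simp add: b_def)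
    have "y = (x - b) * t + b * u" using b by (simp add: algebra_simps)
    moreover have "z = (x - b) * t\<^sup>2 + b * u\<^sup>2"
    proof -
      have "(x - b) * t\<^sup>2 + b * u\<^sup>2 = x * t\<^sup>2 + (b * (u - t)) * (u + t)"
        by (simp add: algebra_simps power2_eq_square)
      also have "\<dots> = y * t - u * (x * t - y)" unfolding b by (simp add: algebra_simps power2_eq_square)
      finally show ?thesis by (simp add: u)
    qed
    ultimately have "s = (x - b) \<cdot>\<^sub>v pt t + b \<cdot>\<^sub>v pt u" unfolding comb_pt by simp
    then show False using t pt_inj[OF \<open>u \<noteq> t\<close>] by (auto simp: points)
  qed
  show ?thesis
  proof (cases "x = 0")
    case False
    have "inf \<notin> ?T"
    proof
      assume "inf \<in> ?T"
      \<comment> \<open>The line from \<open>inf\<close> through \<open>s\<close> meets the conic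
        again at parameter \<open>y / x\<close>.\<close>
      moreover have "s = (z - x * (y / x)\<^sup>2) \<cdot>\<^sub>v inf + x \<cdot>\<^sub>v pt (y / x)"
        unfolding comm comb_inf using False by simp
      ultimately show False using pt_inf[of "y / x"] by (auto simp: points)
    qed
    have "?T \<subseteq> pt ` {t. x * t\<^sup>2 + (- 2 * y) * t + z = 0}"
    proof
      fix v assume v: "v \<in> ?T"
      then have "v \<in> insert inf (range pt)" unfolding points by blast
      moreover have "v \<noteq> inf" using v \<open>inf \<notin> ?T\<close> by blast
      ultimately obtain t where "v = pt t" by blast
      then show "v \<in> pt ` {t. x * t\<^sup>2 + (- 2 * y) * t + z = 0}" using tangent_pt v by blast
    qed
    then have "card ?T \<le> card {t. x * t\<^sup>2 + (- 2 * y) * t + z = 0}"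
      by (intro surj_card_le) simp_all
    then show ?thesis using card_quadratic_roots_le[OF False, of "- 2 * y" z] by simp
  next
    \<comment> \<open>The polar equation degenerates to \<open>2 * y * t = z\<close>, with a single
      root since 2 and \<open>y\<close> are nonzero; \<open>inf\<close> is the other possible
      tangent point.\<close>
    case True
    have "y \<noteq> 0"
    proof
      assume "y = 0"
      then have "s = z \<cdot>\<^sub>v inf"
        using True s carrier by (subst vec_eq_3) (auto simp: inf_def x_def y_def z_def)
      then show False using off[of inf z] by (simp add: points)
    qed
    have root: "t = z / (2 * y)" if "pt t \<in> ?T" for t
      using tangent_pt[OF that] True two \<open>y \<noteq> 0\<close> by (simp add: field_simps)
    have "?T \<subseteq> {inf, pt (z / (2 * y))}"
    proof
      fix v assume v: "v \<in> ?T"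
      then have "v \<in> insert inf (range pt)" unfolding points by blast
      then show "v \<in> {inf, pt (z / (2 * y))}" using root v by blast
    qed
    then have "card ?T \<le> card {inf, pt (z / (2 * y))}" by (intro card_mono) auto
    also have "\<dots> \<le> 2" by (simp add: card_insert_if)
    finally show ?thesis .
  qed
qed

lemma scaled_columnsE:
  fixes H :: "'a::field mat"
  assumes "H \<in> carrier_mat r n" "scaled_columns H S"
  obtains p c where "bij_betw p {..<n} S" "\<And>j. j < n \<Longrightarrow> p j = c j \<cdot>\<^sub>v col H j"
proof -
  have dim: "dim_col H = n" using assms(1) by simp
  obtain p where p: "bij_betw p {..<n} S"
    and col: "\<forall>j<n. \<exists>a. a \<noteq> 0 \<and> col H j = a \<cdot>\<^sub>v p j"
    using assms(2) unfolding scaled_columns_def dim by blast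
  have "\<forall>j. \<exists>b. j < n \<longrightarrow> p j = b \<cdot>\<^sub>v col H j"
  proof
    fix j
    show "\<exists>b. j < n \<longrightarrow> p j = b \<cdot>\<^sub>v col H j"
    proof (cases "j < n")
      case True
      then obtain a where a: "a \<noteq> 0" "col H j = a \<cdot>\<^sub>v p j" using col by blast
      have "inverse a \<cdot>\<^sub>v col H j = p j" unfolding a(2) smult_smult_assoc using a(1) by simp
      then show ?thesis by metis
    qed simp
  qed
  then obtain c where "\<forall>j. j < n \<longrightarrow> p j = c j \<cdot>\<^sub>v col H j" by (rule choice[THEN exE])
  then show thesis using that p by blast
qed

text \<open>Each point is a multiple of its column, so a secant through two points is a secant
  through the two columns; hence tangent columns go to tangent points.\<close>

lemma card_tangent_cols_conic:
  fixes H :: "'a::{field,finite} mat"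
  assumes two: "(2 :: 'a) \<noteq> 0" and H: "H \<in> carrier_mat 3 n" "scaled_columns H (gdrs_points 4)"
    and s: "s \<in> carrier_vec 3" "s \<notin> multiples_of_cols H"
  shows "card (tangent_cols H s) \<le> 2"
proof -
  have dim: "dim_col H = n" using H(1) by simp
  define S :: "'a vec set" where "S = gdrs_points 4"
  define T where "T = {v \<in> S. \<forall>w \<in> S. w \<noteq> v \<longrightarrow> (\<forall>a b. s \<noteq> a \<cdot>\<^sub>v v + b \<cdot>\<^sub>v w)}"
  obtain p c where p: "bij_betw p {..<n} S" and c: "\<And>j. j < n \<Longrightarrow> p j = c j \<cdot>\<^sub>v col H j"
    using scaled_columnsE[OF H] unfolding S_def by metis
  have img: "p ` {..<n} = S" using p by (rule bij_betw_imp_surj_on)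
  have off: "s \<noteq> a \<cdot>\<^sub>v w" if w: "w \<in> S" for w a
  proof -
    obtain j where j: "j < n" "w = p j" using w img by blast
    have "a \<cdot>\<^sub>v w = (a * c j) \<cdot>\<^sub>v col H j" unfolding j(2) c[OF j(1)] by (rule smult_smult_assoc)
    then have "a \<cdot>\<^sub>v w \<in> multiples_of_cols H" using j(1) unfolding multiples_of_cols_def dim by blast
    then show ?thesis using s(2) by blast
  qed
  have "card T \<le> 2"
    unfolding T_def S_def by (rule conic_tangents[OF two s(1) off]) (simp add: S_def)
  moreover have "p ` tangent_cols H s \<subseteq> T"
  proof
    fix v assume "v \<in> p ` tangent_cols H s"
    then obtain i where v: "v = p i" and i: "i \<in> tangent_cols H s" by blast
    have i_less: "i < n" and tan: "\<And>j a b. j < n \<Longrightarrow> j \<noteq> i \<Longrightarrow> s \<noteq> a \<cdot>\<^sub>v col H i + b \<cdot>\<^sub>v col H j"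
      using i unfolding tangent_cols_def dim by simp_all
    have "s \<noteq> a \<cdot>\<^sub>v v + b \<cdot>\<^sub>v w" if w: "w \<in> S" "w \<noteq> v" for w a b
    proof -
      obtain j where j: "j < n" "w = p j" using w(1) img by blast
      then have "j \<noteq> i" using w(2) v by blast
      from tan[OF j(1) this, of "a * c i" "b * c j"] show ?thesis
        unfolding v j(2) c[OF i_less] c[OF j(1)] smult_smult_assoc .
    qed
    moreover have "v \<in> S" using v i_less img by blast
    ultimately show "v \<in> T" unfolding T_def by blast
  qed
  moreover have "finite T"
    by (rule finite_subset[of _ S]) (auto simp: S_def T_def gdrs_points_def)
  moreover have "inj_on p (tangent_cols H s)"
    by (rule inj_on_subset[OF bij_betw_imp_inj_on[OF p]]) (auto simp: tangent_cols_def dim)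
  ultimately show ?thesis using card_inj_on_le[of p "tangent_cols H s" T] by linarith
qed

section \<open>Removing columns of a parity check matrix\<close>

lemma two_le_card: "2 \<le> CARD('a::{field,finite})"
  using card_mono[of UNIV "{0, 1 :: 'a}"] by simp

lemma mds_code_remove_cols:
  fixes H :: "'a::{field,finite} mat"
  assumes mds: "mds_code n k d C" and d: "3 \<le> d" and H: "parity_check_matrix n k C H"
    and D: "1 \<le> card D" "card D \<le> n - d" "D \<subseteq> {..<n}"
  defines "C' \<equiv> mat_kernel (remove_cols H D)"
  shows "mds_code (n - card D) (k - card D) d C'"
    and "covering_radius (n - card D) C' = d - 1"
    and "(CARD('a) - 1) * card D \<le> num_cosets (n - card D) (d - 1) C'"
    and "card (deep_holes (n - card D) C') =
      CARD('a) ^ (k - card D) * num_cosets (n - card D) (d - 1) C'"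
proof -
  have k: "d = n - k + 1" "min_distance C = d"
    using mds by (auto simp: mds_code_def linear_code_def)
  then have r: "n - k = d - 1" by simp
  have Hc: "H \<in> carrier_mat (d - 1) n" and C: "mat_kernel H = C"
    using H by (auto simp: parity_check_matrix_def r)
  have gp: "general_position H"
    using general_position_of_min_distance[OF Hc] k(2) d C by simp
  \<comment> \<open>The bound on \<open>card D\<close> leaves at least one column more than rows, as
    needed for distance exactly \<open>d\<close>.\<close>
  have n: "d - 1 + card D \<le> n" "d - 1 < n - card D" "n - card D - (d - 1) = k - card D"
    using D k(1) d by auto
  have "D \<noteq> {}" using D(1) by auto
  have H': "remove_cols H D \<in> carrier_mat (d - 1) (n - card D)"
    by (rule remove_cols_carrier[OF Hc D(3)])
  have gp': "general_position (remove_cols H D)"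
    by (rule general_position_remove_cols[OF Hc gp D(3)])
  show "mds_code (n - card D) (k - card D) d C'"
    using mds_code_general_position[OF H' gp' n(2)] d unfolding n(3) C'_def by simp
  show cr: "covering_radius (n - card D) C' = d - 1"
    unfolding C'_def by (rule covering_radius_remove_cols[OF Hc gp D(3) \<open>D \<noteq> {}\<close> n(1)])
  show "(CARD('a) - 1) * card D \<le> num_cosets (n - card D) (d - 1) C'"
    unfolding C'_def using d by (intro num_cosets_remove_cols_ge[OF Hc gp _ D(3) n(1)]) simp
  show "card (deep_holes (n - card D) C') =
      CARD('a) ^ (k - card D) * num_cosets (n - card D) (d - 1) C'"
    using card_deep_holes_kernel[OF H'] cr card_mat_kernel_general_position[OF H' gp'] n(2,3)
    unfolding C'_def by simp
qed

text \<open>On the projective line no syndrome lies off the columns, so the condition on such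
  syndromes is vacuous. The bound \<open>q - 2\<close> is \<open>q + 1 - n_3(q)\<close>.\<close>

lemma gdrs_code_3:
  fixes H :: "'a::{field,finite} mat"
  assumes H: "is_H 3 H"
  shows "mds_code (CARD('a) + 1) (CARD('a) - 1) 3 (mat_kernel H)"
    and "covering_radius (CARD('a) + 1) (mat_kernel H) = 1"
    and "D \<subseteq> {..<CARD('a) + 1} \<Longrightarrow> card D \<le> CARD('a) - 2 \<Longrightarrow>
      num_cosets (CARD('a) + 1 - card D) 2 (mat_kernel (remove_cols H D)) = (CARD('a) - 1) * card D"
proof -
  have q: "2 \<le> CARD('a)" by (rule two_le_card)
  have Hc: "H \<in> carrier_mat 2 (CARD('a) + 1)" using H by (simp add: is_H_def)
  note gp = general_position_H3[OF H]
  note all = all_multiples_of_cols[OF Hc gp]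
  show "mds_code (CARD('a) + 1) (CARD('a) - 1) 3 (mat_kernel H)"
    using mds_code_general_position[OF Hc gp] q by simp
  show "covering_radius (CARD('a) + 1) (mat_kernel H) = 1"
    using covering_radius_short[OF Hc gp] all q by simp
  show "num_cosets (CARD('a) + 1 - card D) 2 (mat_kernel (remove_cols H D)) = (CARD('a) - 1) * card D"
    if "D \<subseteq> {..<CARD('a) + 1}" "card D \<le> CARD('a) - 2"
    using num_cosets_remove_cols_eq[OF Hc gp order_refl that(1)] all that(2) q by simp
qed

text \<open>\<open>m\<close> bounds the tangents through a point off the arc: 2 for the conic with
  \<open>q\<close> odd, 0 for the hyperoval. The case \<open>D = {}\<close> gives the covering
  radius.\<close>

lemma few_tangents_code:
  fixes H :: "'a::{field,finite} mat"
  assumes Hc: "H \<in> carrier_mat 3 n" and gp: "general_position H" and n: "3 < n" "m < n"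
    and T: "\<And>s. s \<in> carrier_vec 3 \<Longrightarrow> s \<notin> multiples_of_cols H \<Longrightarrow> card (tangent_cols H s) \<le> m"
  shows "mds_code n (n - 3) 4 (mat_kernel H)"
    and "covering_radius n (mat_kernel H) = 2"
    and "D \<subseteq> {..<n} \<Longrightarrow> 3 + card D \<le> n \<Longrightarrow> m + 2 * card D < n \<Longrightarrow>
      num_cosets (n - card D) 3 (mat_kernel (remove_cols H D)) = (CARD('a) - 1) * card D"
proof -
  have short: "\<exists>v \<in> carrier_vec n. supp v \<inter> D = {} \<and> hamming_weight v < 3 \<and> H *\<^sub>v v = s"
    if D: "D \<subseteq> {..<n}" "m + 2 * card D < n" and s: "s \<in> carrier_vec 3" "s \<notin> multiples_of_cols H" for D s
    using T[OF s] D(2) by (intro short_if_few_tangents[OF Hc gp D(1) s(2)]) linarith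
  show "mds_code n (n - 3) 4 (mat_kernel H)"
    using mds_code_general_position[OF Hc gp n(1)] by simp
  show "covering_radius n (mat_kernel H) = 2"
    using covering_radius_short[OF Hc gp] short[of "{}"] n by simp
  show "num_cosets (n - card D) 3 (mat_kernel (remove_cols H D)) = (CARD('a) - 1) * card D"
    if D: "D \<subseteq> {..<n}" "3 + card D \<le> n" "m + 2 * card D < n"
    using num_cosets_remove_cols_eq[OF Hc gp _ D(1,2) short[OF D(1,3)]] by simp
qed

lemma gdrs_code_4:
  fixes H :: "'a::{field,finite} mat"
  assumes q: "odd CARD('a)" and H: "is_H 4 H"
  shows "mds_code (CARD('a) + 1) (CARD('a) - 2) 4 (mat_kernel H)"
    and "covering_radius (CARD('a) + 1) (mat_kernel H) = 2"
    and "D \<subseteq> {..<CARD('a) + 1} \<Longrightarrow> card D \<le> CARD('a) + 1 - (CARD('a) + 5) div 2 \<Longrightarrow>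
      num_cosets (CARD('a) + 1 - card D) 3 (mat_kernel (remove_cols H D)) = (CARD('a) - 1) * card D"
proof -
  have q3: "3 \<le> CARD('a)" using q two_le_card[where 'a = 'a] by (cases "CARD('a) = 2") auto
  have Hc: "H \<in> carrier_mat 3 (CARD('a) + 1)" and sc: "scaled_columns H (gdrs_points 4)"
    using H by (auto simp: is_H_def)
  have gp: "general_position H" using q3 by (intro general_position_conic[OF Hc _ sc]) auto
  note code = few_tangents_code[OF Hc gp _ _
      card_tangent_cols_conic[OF two_neq_0_if_odd_card[OF q] Hc sc]]
  show "mds_code (CARD('a) + 1) (CARD('a) - 2) 4 (mat_kernel H)" using code(1) q3 by simp
  show "covering_radius (CARD('a) + 1) (mat_kernel H) = 2" using code(2) q3 by simp
  show "num_cosets (CARD('a) + 1 - card D) 3 (mat_kernel (remove_cols H D)) = (CARD('a) - 1) * card D"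
    if D: "D \<subseteq> {..<CARD('a) + 1}" "card D \<le> CARD('a) + 1 - (CARD('a) + 5) div 2"
  proof (rule code(3))
    \<comment> \<open>The bound becomes \<open>card D <= m - 1\<close>, which is exactly
      \<open>2 + 2 * card D < q + 1\<close>.\<close>
    obtain m where "CARD('a) = 2 * m + 1" using q by (auto elim: oddE)
    then show "3 + card D \<le> CARD('a) + 1" "2 + 2 * card D < CARD('a) + 1" using D(2) q3 by auto
  qed (use q3 D in auto)
qed

text \<open>For \<open>q\<close> even \<open>(0,1,0)\<close> is the nucleus, common to all tangents
  of the conic; adjoining it therefore keeps any three columns independent.\<close>

lemma hyperoval_code:
  fixes H :: "'a::{field,finite} mat"
  assumes q: "even CARD('a)" and H: "is_H4_tilde H"
  shows "mds_code (CARD('a) + 2) (CARD('a) - 1) 4 (mat_kernel H)"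
    and "covering_radius (CARD('a) + 2) (mat_kernel H) = 2"
    and "D \<subseteq> {..<CARD('a) + 2} \<Longrightarrow> card D \<le> CARD('a) + 2 - (1 + (CARD('a) + 4) div 2) \<Longrightarrow>
      num_cosets (CARD('a) + 2 - card D) 3 (mat_kernel (remove_cols H D)) = (CARD('a) - 1) * card D"
proof -
  have q2: "2 \<le> CARD('a)" by (rule two_le_card)
  have Hc: "H \<in> carrier_mat 3 (CARD('a) + 2)"
    and sc: "scaled_columns H (insert (unit_vec 3 1) (gdrs_points 4))"
    using H by (auto simp: is_H4_tilde_def)
  have gp: "general_position H" using q q2 by (intro general_position_conic[OF Hc _ sc]) auto
  have "card (tangent_cols H s) \<le> 0" if "s \<in> carrier_vec 3" "s \<notin> multiples_of_cols H" for s
    using hyperoval_no_tangents[OF Hc gp that] by simp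
  note code = few_tangents_code[OF Hc gp _ _ this]
  show "mds_code (CARD('a) + 2) (CARD('a) - 1) 4 (mat_kernel H)" using code(1) q2 by simp
  show "covering_radius (CARD('a) + 2) (mat_kernel H) = 2" using code(2) q2 by simp
  show "num_cosets (CARD('a) + 2 - card D) 3 (mat_kernel (remove_cols H D)) = (CARD('a) - 1) * card D"
    if D: "D \<subseteq> {..<CARD('a) + 2}" "card D \<le> CARD('a) + 2 - (1 + (CARD('a) + 4) div 2)"
  proof (rule code(3))
    \<comment> \<open>The bound becomes \<open>card D <= m - 1\<close>, hence
      \<open>2 * card D < q + 2\<close>.\<close>
    obtain m where "CARD('a) = 2 * m" using q by (auto elim: evenE)
    then show "3 + card D \<le> CARD('a) + 2" "0 + 2 * card D < CARD('a) + 2" using D(2) q2 by auto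
  qed (use q2 D in auto)
qed

theorem theorem7p10:
  fixes q :: nat
  assumes q: "q = CARD('a::{field,finite})"
  shows
    "(\<forall>n k d \<Delta> (C :: 'a vec set) H D C'.
        mds_code n k d C \<and> 3 \<le> d \<and> covering_radius n C = d - 2 \<and>
        parity_check_matrix n k C H \<and>
        1 \<le> \<Delta> \<and> \<Delta> \<le> n - d \<and> D \<subseteq> {..<n} \<and> card D = \<Delta> \<and>
        C' = mat_kernel (remove_cols H D) \<longrightarrow>
          mds_code (n - \<Delta>) (k - \<Delta>) d C' \<and>
          covering_radius (n - \<Delta>) C' = d - 1 \<and>
          num_cosets (n - \<Delta>) (d - 1) C' \<ge> (q - 1) * \<Delta> \<and>
          card (deep_holes (n - \<Delta>) C') = q ^ (k - \<Delta>) * num_cosets (n - \<Delta>) (d - 1) C')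
   \<and>
     (\<forall>d (C :: 'a vec set) H.
        d \<in> {3, 4} \<and> (d = 4 \<longrightarrow> odd q) \<and>
        is_H d H \<and> parity_check_matrix (q + 1) (q + 2 - d) C H \<longrightarrow>
          mds_code (q + 1) (q + 2 - d) d C \<and> covering_radius (q + 1) C = d - 2 \<and>
          (\<forall>\<Delta> D C'. 1 \<le> \<Delta> \<and> \<Delta> \<le> (q + 1) - d \<and> D \<subseteq> {..<q + 1} \<and> card D = \<Delta> \<and>
             C' = mat_kernel (remove_cols H D) \<and>
             \<Delta> \<le> (q + 1) - n_bound d q \<longrightarrow>
               num_cosets (q + 1 - \<Delta>) (d - 1) C' = (q - 1) * \<Delta>))
   \<and>
     (\<forall>(C :: 'a vec set) H.
        even q \<and> is_H4_tilde H \<and> parity_check_matrix (q + 2) (q - 1) C H \<longrightarrow>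
          mds_code (q + 2) (q - 1) 4 C \<and> covering_radius (q + 2) C = 2 \<and>
          (\<forall>\<Delta> D C'. 1 \<le> \<Delta> \<and> \<Delta> \<le> (q + 2) - 4 \<and> D \<subseteq> {..<q + 2} \<and> card D = \<Delta> \<and>
             C' = mat_kernel (remove_cols H D) \<and>
             \<Delta> \<le> (q + 2) - (1 + (q + 4) div 2) \<and>
             (\<exists>j \<in> D. \<exists>a. a \<noteq> 0 \<and> col H j = a \<cdot>\<^sub>v unit_vec 3 1) \<longrightarrow>
               num_cosets (q + 2 - \<Delta>) 3 C' = (q - 1) * \<Delta>))"
proof (intro conjI allI impI, goal_cases)
  case (1 n k d \<Delta> C H D C')
  then show ?case using mds_code_remove_cols(1)[of n k d C H D] by (simp add: q)
next
  case (2 n k d \<Delta> C H D C')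
  then show ?case using mds_code_remove_cols(2)[of n k d C H D] by (simp add: q)
next
  case (3 n k d \<Delta> C H D C')
  then show ?case using mds_code_remove_cols(3)[of n k d C H D] by (simp add: q)
next
  case (4 n k d \<Delta> C H D C')
  then show ?case using mds_code_remove_cols(4)[of n k d C H D] by (simp add: q)
next
  case (5 d C H)
  then have C: "C = mat_kernel H" by (simp add: parity_check_matrix_def)
  show ?case using 5 gdrs_code_3(1)[of H] gdrs_code_4(1)[of H] unfolding C q by auto
next
  case (6 d C H)
  then have C: "C = mat_kernel H" by (simp add: parity_check_matrix_def)
  show ?case using 6 gdrs_code_3(2)[of H] gdrs_code_4(2)[of H] unfolding C q by auto
next
  case (7 d C H \<Delta> D C')
  then show ?case using gdrs_code_3(3)[of H D] gdrs_code_4(3)[of H D] unfolding q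
    by (auto simp: n_bound_def)
next
  case (8 C H)
  then have C: "C = mat_kernel H" by (simp add: parity_check_matrix_def)
  show ?case using 8 hyperoval_code(1)[of H] unfolding C q by auto
next
  case (9 C H)
  then have C: "C = mat_kernel H" by (simp add: parity_check_matrix_def)
  show ?case using 9 hyperoval_code(2)[of H] unfolding C q by auto
next
  case (10 C H \<Delta> D C')
  then show ?case using hyperoval_code(3)[of H D] unfolding q by auto
qed

end
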